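(* Let $T$ be a locally finite rooted tree, $\ell$ a length function on $T$, and $\chi$ a capacity function on $T$, and let $\Gamma$ be the metric realization of $(T,\ell)$. Then the sequence $(a_n)$ produced by the greedy procedure with capacities depends only on the pair $(\Gamma,\chi)$. That is: if $(T_1,\ell_1,\chi_1)$ and $(T_2,\ell_2,\chi_2)$ are two such triples for which there is a root-preserving isometry between the metric realizations of $(T_1,\ell_1)$ and $(T_2,\ell_2)$ which carries $\chi_1$ to $\chi_2$ under the induced bijection of leaves (possibly the two triples being equal), then any two sequences produced by the greedy procedure with capacities for these triples, each continued as long as possible, yield sequences $(a_n)$ and $(a_n')$ of the same (finite or infinite) length with $a_n=a'_n$ for every index $n$.
   Context: A rooted tree $T$ has root $\mathfrak r$ and edges oriented away from the root; $E(T)$ is the set of oriented edges. A length function is a map $\ell:E(T)\to\mathbb R_{+}$ with (strictly) positive values. The metric realization of $(T,\ell)$ is the rooted metric tree obtained by replacing each edge $e$ with an interval of length $\ell(e)$, with the path metric. A leaf of $T$ is a vertex $v\ne\mathfrak r$ of valence one; if $T$ is the single vertex $\mathfrak r$, then $\mathfrak r$ is a leaf. $L(T)$ is the set of leaves. A capacity function is a map $\chi:L(T)\to\{1,2,3,\dots\}\cup\{\infty\}$. The boundary $\partial T$ is the set of infinite oriented paths starting at $\mathfrak r$; the extended boundary $\widetilde\partial T$ is the union of $\partial T$ and the set of oriented paths from $\mathfrak r$ to a leaf (the latter identified with leaves). For $\rho,\tau\in\widetilde\partial T$ (with $\rho\ne\tau$ if both lie in $\partial T$), $\langle\rho,\tau\rangle:=\sum_{e\in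 E(\rho)\cap E(\tau)}\ell(e)$, where $E(\rho)$ is the set of edges of $\rho$. Greedy procedure with capacities: choose $\rho_0\in\widetilde\partial T$ arbitrarily, $a_0=0$. Given $\rho_0,\dots,\rho_{n-1}$, call $\rho\in\widetilde\partial T$ admissible if either $\rho\in\partial T$ and $\rho\notin\{\rho_0,\dots,\rho_{n-1}\}$, or $\rho$ is a leaf $v$ which appears strictly fewer than $\chi(v)$ times in $\rho_0,\dots,\rho_{n-1}$. Choose, if possible, $\rho_n$ arbitrarily among the admissible $\rho$ minimizing $\sum_{j=0}^{n-1}\langle\rho,\rho_j\rangle$, and set $a_n:=\sum_{j=0}^{n-1}\langle\rho_n,\rho_j\rangle$. If there is no admissible $\rho$, the procedure stops. *)

theory Defs
  imports Complex_Main "HOL-Library.Extended_Nat"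
begin

section \<open>Rooted trees\<close>

record 'v rtree =
  tverts :: "'v set"
  tedges :: "('v \<times> 'v) set"
  troot :: 'v

text \<open>An edge \<open>(u, v)\<close> is oriented from \<open>u\<close> to \<open>v\<close>. An oriented path is given by the list of
  its vertices; the path of length zero from \<open>u\<close> to \<open>u\<close> is \<open>[u]\<close>.\<close>

definition oriented_path :: "'v rtree \<Rightarrow> 'v \<Rightarrow> 'v list \<Rightarrow> 'v \<Rightarrow> bool" where
  "oriented_path T u p v \<longleftrightarrow>
     p \<noteq> [] \<and> hd p = u \<and> last p = v \<and> set p \<subseteq> tverts T \<and>
     successively (\<lambda>x y. (x, y) \<in> tedges T) p"

text \<open>A tree with all edges oriented away from the root, that is, an out-arborescence. Vertices
  may be repeated in \<open>oriented_path\<close>, so uniqueness also excludes loops and directed cycles, and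
  edges into the root.\<close>

definition rooted_tree :: "'v rtree \<Rightarrow> bool" where
  "rooted_tree T \<longleftrightarrow>
     troot T \<in> tverts T \<and> tedges T \<subseteq> tverts T \<times> tverts T \<and>
     (\<forall>v\<in>tverts T. \<exists>!p. oriented_path T (troot T) p v)"

definition incident_edges :: "'v rtree \<Rightarrow> 'v \<Rightarrow> ('v \<times> 'v) set" where
  "incident_edges T v = {e \<in> tedges T. fst e = v \<or> snd e = v}"

definition locally_finite_tree :: "'v rtree \<Rightarrow> bool" where
  "locally_finite_tree T \<longleftrightarrow> (\<forall>v\<in>tverts T. finite (incident_edges T v))"

definition leaves :: "'v rtree \<Rightarrow> 'v set" where
  "leaves T =
     {v \<in> tverts T. v \<noteq> troot T \<and> card (incident_edges T v) = 1
                    \<or> v = troot T \<and> tverts T = {troot T}}"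

definition length_function :: "'v rtree \<Rightarrow> ('v \<times> 'v \<Rightarrow> real) \<Rightarrow> bool" where
  "length_function T l \<longleftrightarrow> (\<forall>e\<in>tedges T. 0 < l e)"

definition capacity_function :: "'v rtree \<Rightarrow> ('v \<Rightarrow> enat) \<Rightarrow> bool" where
  "capacity_function T \<chi> \<longleftrightarrow> (\<forall>v\<in>leaves T. 1 \<le> \<chi> v)"


section \<open>Metric realization\<close>

text \<open>\<open>Interior e t\<close> is the point in the interior of the edge \<open>e\<close> at distance \<open>t\<close> from the
  tail of \<open>e\<close>.\<close>

datatype 'v point = Vertex 'v | Interior "'v \<times> 'v" real

definition realization :: "'v rtree \<Rightarrow> ('v \<times> 'v \<Rightarrow> real) \<Rightarrow> 'v point set" where
  "realization T l =
     Vertex ` tverts T \<union> {Interior e t | e t. e \<in> tedges T \<and> 0 < t \<and> t < l e}"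

text \<open>The gluing map of the interval \<open>[0, l e]\<close> into the realization.\<close>

definition edge_point :: "('v \<times> 'v \<Rightarrow> real) \<Rightarrow> 'v \<times> 'v \<Rightarrow> real \<Rightarrow> 'v point" where
  "edge_point l e t =
     (if t = 0 then Vertex (fst e) else if t = l e then Vertex (snd e) else Interior e t)"

text \<open>\<open>realization_path T l x y c\<close>: a finite concatenation of segments, each contained in a
  closed edge, leads from \<open>x\<close> to \<open>y\<close> and has total length \<open>c\<close>. The path metric is the infimum
  of these lengths.\<close>

inductive realization_path ::
  "'v rtree \<Rightarrow> ('v \<times> 'v \<Rightarrow> real) \<Rightarrow> 'v point \<Rightarrow> 'v point \<Rightarrow> real \<Rightarrow> bool"
  for T :: "'v rtree" and l :: "'v \<times> 'v \<Rightarrow> real" and x :: "'v point" where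
  start: "x \<in> realization T l \<Longrightarrow> realization_path T l x x 0"
| segment: "realization_path T l x (edge_point l e s) c \<Longrightarrow> e \<in> tedges T \<Longrightarrow>
     s \<in> {0..l e} \<Longrightarrow> t \<in> {0..l e} \<Longrightarrow>
     realization_path T l x (edge_point l e t) (c + \<bar>s - t\<bar>)"

definition path_metric :: "'v rtree \<Rightarrow> ('v \<times> 'v \<Rightarrow> real) \<Rightarrow> 'v point \<Rightarrow> 'v point \<Rightarrow> real" where
  "path_metric T l x y = Inf {c. realization_path T l x y c}"

definition rooted_isometry ::
  "'v rtree \<Rightarrow> ('v \<times> 'v \<Rightarrow> real) \<Rightarrow> 'w rtree \<Rightarrow> ('w \<times> 'w \<Rightarrow> real) \<Rightarrow> ('v point \<Rightarrow> 'w point) \<Rightarrow> bool"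
where
  "rooted_isometry T1 l1 T2 l2 f \<longleftrightarrow>
     bij_betw f (realization T1 l1) (realization T2 l2) \<and>
     (\<forall>x\<in>realization T1 l1. \<forall>y\<in>realization T1 l1.
        path_metric T2 l2 (f x) (f y) = path_metric T1 l1 x y) \<and>
     f (Vertex (troot T1)) = Vertex (troot T2)"

text \<open>A rooted isometry maps leaves bijectively to leaves. This is not part of the following
  condition, which only compares the capacities of leaves that correspond to each other.\<close>

definition carries_capacity ::
  "'v rtree \<Rightarrow> ('v \<Rightarrow> enat) \<Rightarrow> 'w rtree \<Rightarrow> ('w \<Rightarrow> enat) \<Rightarrow> ('v point \<Rightarrow> 'w point) \<Rightarrow> bool" where
  "carries_capacity T1 \<chi>1 T2 \<chi>2 f \<longleftrightarrow>
     (\<forall>v\<in>leaves T1. \<forall>w\<in>leaves T2. f (Vertex v) = Vertex w \<longrightarrow> \<chi>2 w = \<chi>1 v)"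


section \<open>The extended boundary\<close>

text \<open>An infinite path is the sequence of its vertices; a leaf \<open>v\<close> is represented by the oriented
  path from the root to \<open>v\<close>, and is recovered as the last vertex of that path.\<close>

datatype 'v ext_path = Ray "nat \<Rightarrow> 'v" | Leaf_Path "'v list"

definition tree_boundary :: "'v rtree \<Rightarrow> (nat \<Rightarrow> 'v) set" where
  "tree_boundary T = {x. x 0 = troot T \<and> (\<forall>n. (x n, x (Suc n)) \<in> tedges T)}"

definition ext_boundary :: "'v rtree \<Rightarrow> 'v ext_path set" where
  "ext_boundary T =
     Ray ` tree_boundary T \<union>
     Leaf_Path ` {p. \<exists>v\<in>leaves T. oriented_path T (troot T) p v}"

fun path_edges :: "'v ext_path \<Rightarrow> ('v \<times> 'v) set" where
  "path_edges (Ray x) = range (\<lambda>n. (x n, x (Suc n)))"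
| "path_edges (Leaf_Path p) = set (zip p (tl p))"

text \<open>The set of common edges is infinite only for two equal infinite paths, where the pairing
  is left undefined in the mathematics (here \<open>sum\<close> gives 0). This case does not occur in the greedy
  procedure, where an infinite path is used at most once.\<close>

definition pairing :: "('v \<times> 'v \<Rightarrow> real) \<Rightarrow> 'v ext_path \<Rightarrow> 'v ext_path \<Rightarrow> real" where
  "pairing l \<rho> \<tau> = (\<Sum>e \<in> path_edges \<rho> \<inter> path_edges \<tau>. l e)"


section \<open>The greedy procedure with capacities\<close>

text \<open>The history \<open>\<rho>\<^sub>0, \<dots>, \<rho>\<^sub>n\<^sub>-\<^sub>1\<close> is given by the values of \<open>\<rho>\<close> at the indices below \<open>n\<close>.\<close>

definition admissible ::
  "'v rtree \<Rightarrow> ('v \<Rightarrow> enat) \<Rightarrow> (nat \<Rightarrow> 'v ext_path) \<Rightarrow> nat \<Rightarrow> 'v ext_path \<Rightarrow> bool" where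
  "admissible T \<chi> \<rho> n \<tau> \<longleftrightarrow>
     \<tau> \<in> ext_boundary T \<and>
     (case \<tau> of
        Ray x \<Rightarrow> \<tau> \<notin> \<rho> ` {..<n}
      | Leaf_Path p \<Rightarrow> enat (card {j. j < n \<and> \<rho> j = \<tau>}) < \<chi> (last p))"

definition greedy_sum ::
  "('v \<times> 'v \<Rightarrow> real) \<Rightarrow> (nat \<Rightarrow> 'v ext_path) \<Rightarrow> nat \<Rightarrow> 'v ext_path \<Rightarrow> real" where
  "greedy_sum l \<rho> n \<tau> = (\<Sum>j<n. pairing l \<tau> (\<rho> j))"

text \<open>For \<open>n = 0\<close> the sum is empty and, as capacities are at least 1, every element of the
  extended boundary is a greedy choice.\<close>

definition greedy_choice ::
  "'v rtree \<Rightarrow> ('v \<times> 'v \<Rightarrow> real) \<Rightarrow> ('v \<Rightarrow> enat) \<Rightarrow> (nat \<Rightarrow> 'v ext_path) \<Rightarrow> nat \<Rightarrow> 'v ext_path \<Rightarrow> bool"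
where
  "greedy_choice T l \<chi> \<rho> n \<tau> \<longleftrightarrow> is_arg_min (greedy_sum l \<rho> n) (admissible T \<chi> \<rho> n) \<tau>"

text \<open>A run of length \<open>N\<close>, finite or infinite, continued as long as possible; the values of \<open>\<rho>\<close> at
  indices \<open>\<ge> N\<close> are irrelevant.\<close>

definition greedy_run ::
  "'v rtree \<Rightarrow> ('v \<times> 'v \<Rightarrow> real) \<Rightarrow> ('v \<Rightarrow> enat) \<Rightarrow> enat \<Rightarrow> (nat \<Rightarrow> 'v ext_path) \<Rightarrow> bool" where
  "greedy_run T l \<chi> N \<rho> \<longleftrightarrow>
     (\<forall>n. enat n < N \<longrightarrow> greedy_choice T l \<chi> \<rho> n (\<rho> n)) \<and>
     (\<forall>n. N = enat n \<longrightarrow> (\<nexists>\<tau>. greedy_choice T l \<chi> \<rho> n \<tau>))"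

definition greedy_value :: "('v \<times> 'v \<Rightarrow> real) \<Rightarrow> (nat \<Rightarrow> 'v ext_path) \<Rightarrow> nat \<Rightarrow> real" where
  "greedy_value l \<rho> n = greedy_sum l \<rho> n (\<rho> n)"

end

theory Submission
  imports Defs
begin

text \<open>Replacing a leaf \<open>v\<close> by \<open>\<chi> v\<close> copies, the pairing becomes an ultrametric similarity on distinct
  elements. Given a greedy sequence \<open>c\<^sub>0, \<dots>, c\<^sub>n\<^sub>-\<^sub>1\<close> and a set \<open>D\<close> of \<open>n + 1\<close> elements, match each \<open>c\<^sub>j\<close>
  in turn with the nearest element of \<open>D\<close> not yet matched. By the ultrametric inequality the element
  \<open>x\<close> left over satisfies \<open>\<Sum>\<^sub>j \<langle>x, c\<^sub>j\<rangle> \<le> \<Sum>\<^sub>y \<langle>x, y\<rangle>\<close>, where \<open>y\<close> ranges over \<open>D - {x}\<close>. Hence greedy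
  sequences minimize the total pairing among sets of given size, and \<open>a\<^sub>n\<close> is the difference of two
  consecutive minima. These depend only on the pairing, which is read off from the metric: elements
  of the extended boundary are the maximal chains for the order of betweenness with respect to the
  root, and \<open>\<langle>\<rho>, \<tau>\<rangle>\<close> is the supremum of the heights of the common points.\<close>

section \<open>Greedy sequences for an ultrametric pairing\<close>

text \<open>Ties let two runs diverge, so their individual choices cannot be compared. The energy of
  a set forgets the order in which the set was built, which is why all comparisons go through it. A
  second obstacle is that an isometry need not send vertices to vertices: a non-root vertex with a
  single outgoing edge leaves no trace in the metric. Paths, edges and levels therefore cannot be
  transported directly, and a boundary element is first turned into a set of points of the
  realization. Among these sets, those with a greatest point come from leaves and the others from
  rays, which also lets capacities be carried across. Finally, a run ends as soon as no minimizer
  exists, so equality of the lengths requires transferring the existence of a minimizer, not merely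
  of an admissible element.\<close>

definition energy :: "('a \<Rightarrow> 'a \<Rightarrow> real) \<Rightarrow> 'a set \<Rightarrow> real" where
  "energy w D = (\<Sum>x\<in>D. \<Sum>y\<in>D - {x}. w x y)"

definition history_sum :: "('a \<Rightarrow> 'a \<Rightarrow> real) \<Rightarrow> (nat \<Rightarrow> 'a) \<Rightarrow> nat \<Rightarrow> 'a \<Rightarrow> real" where
  "history_sum w c k x = (\<Sum>j<k. w x (c j))"

definition greedy_seq :: "'a set \<Rightarrow> ('a \<Rightarrow> 'a \<Rightarrow> real) \<Rightarrow> nat \<Rightarrow> (nat \<Rightarrow> 'a) \<Rightarrow> bool" where
  "greedy_seq X w n c \<longleftrightarrow>
     (\<forall>k<n. is_arg_min (history_sum w c k) (\<lambda>x. x \<in> X - c ` {..<k}) (c k))"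

lemma greedy_seq_mono: "greedy_seq X w n c \<Longrightarrow> m \<le> n \<Longrightarrow> greedy_seq X w m c"
  by (auto simp: greedy_seq_def)

lemma greedy_seq_mem: "greedy_seq X w n c \<Longrightarrow> k < n \<Longrightarrow> c k \<in> X"
  by (auto simp: greedy_seq_def is_arg_min_def)

lemma greedy_seq_inj:
  assumes "greedy_seq X w n c"
  shows "inj_on c {..<n}"
proof -
  have "c i \<noteq> c j" if "i < j" "j < n" for i j
  proof -
    have "c j \<notin> c ` {..<j}" using assms that by (simp add: greedy_seq_def is_arg_min_def)
    with that show ?thesis by (metis imageI lessThan_iff)
  qed
  then show ?thesis
    by (auto simp: inj_on_def) (metis linorder_neqE_nat)
qed

text \<open>In a sum over ordered pairs the new element meets each old one in both positions; hence
  the factor 2 in front of all totals below.\<close>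

lemma energy_insert:
  assumes "finite D" "x \<notin> D" "\<And>x y. w x y = w y x"
  shows "energy w (insert x D) = energy w D + 2 * (\<Sum>y\<in>D. w x y)"
proof -
  have "(\<Sum>z\<in>D. \<Sum>y\<in>insert x D - {z}. w z y) = (\<Sum>z\<in>D. w z x + (\<Sum>y\<in>D - {z}. w z y))"
  proof (rule sum.cong[OF refl])
    fix z assume "z \<in> D"
    with assms(2) have "insert x D - {z} = insert x (D - {z})" by auto
    with assms(1,2) show "(\<Sum>y\<in>insert x D - {z}. w z y) = w z x + (\<Sum>y\<in>D - {z}. w z y)"
      by simp
  qed
  moreover have "(\<Sum>z\<in>D. w z x) = (\<Sum>z\<in>D. w x z)"
    by (rule sum.cong) (auto simp: assms(3))
  moreover have "insert x D - {x} = D" using assms by auto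
  ultimately show ?thesis
    using assms(1,2) by (simp add: energy_def sum.distrib)
qed

lemma energy_image:
  assumes "inj_on G D" "\<And>x y. x \<in> D \<Longrightarrow> y \<in> D \<Longrightarrow> x \<noteq> y \<Longrightarrow> w' (G x) (G y) = w x y"
  shows "energy w' (G ` D) = energy w D"
proof -
  have "(\<Sum>y\<in>G ` D - {G x}. w' (G x) y) = (\<Sum>y\<in>D - {x}. w x y)" if "x \<in> D" for x
  proof -
    have "G ` D - {G x} = G ` (D - {x})"
      using assms(1) that by (auto simp: inj_on_def)
    moreover have "inj_on G (D - {x})"
      using assms(1) by (rule inj_on_subset) auto
    ultimately show ?thesis
      using assms(2) that by (auto simp: sum.reindex intro!: sum.cong)
  qed
  then show ?thesis
    using assms(1) by (simp add: energy_def sum.reindex)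
qed

lemma energy_image_lessThan:
  assumes "inj_on c {..<n}" "\<And>x y. w x y = w y x"
  shows "energy w (c ` {..<n}) = 2 * (\<Sum>k<n. history_sum w c k (c k))"
  using assms(1)
proof (induction n)
  case 0
  show ?case by (simp add: energy_def)
next
  case (Suc n)
  then have inj: "inj_on c {..<n}" and new: "c n \<notin> c ` {..<n}"
    by (auto simp: lessThan_Suc inj_on_insert)
  have "energy w (c ` {..<Suc n}) = energy w (c ` {..<n}) + 2 * (\<Sum>y\<in>c ` {..<n}. w (c n) y)"
    using energy_insert[of "c ` {..<n}" "c n" w] new assms(2) by (simp add: lessThan_Suc)
  also have "(\<Sum>y\<in>c ` {..<n}. w (c n) y) = history_sum w c n (c n)"
    using inj by (simp add: sum.reindex history_sum_def)
  finally show ?case using Suc.IH[OF inj] by simp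
qed

text \<open>The inequality is required for pairwise distinct elements only: in the application the
  pairing of a ray with itself is a default value, so diagonal values must not enter.\<close>

locale ultrametric_pairing =
  fixes X :: "'a set" and w :: "'a \<Rightarrow> 'a \<Rightarrow> real"
  assumes sym: "w x y = w y x"
    and ultra: "x \<in> X \<Longrightarrow> y \<in> X \<Longrightarrow> z \<in> X \<Longrightarrow> x \<noteq> y \<Longrightarrow> y \<noteq> z \<Longrightarrow> x \<noteq> z \<Longrightarrow>
      min (w x y) (w y z) \<le> w x z"
begin

text \<open>Take \<open>v j\<close> nearest to \<open>c j\<close> in \<open>D - v ` {..<j}\<close>, and equal to \<open>c j\<close> if possible.\<close>

lemma successive_projections:
  assumes "finite D" "D \<subseteq> X" "n \<le> card D" "\<And>j. j < n \<Longrightarrow> c j \<in> X"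
  shows "\<exists>v. inj_on v {..<n} \<and> v ` {..<n} \<subseteq> D \<and>
    (\<forall>j<n. \<forall>x\<in>D - v ` {..<n}. x \<noteq> c j \<and> w x (c j) \<le> w x (v j))"
  using assms(3,4)
proof (induction n)
  case 0
  show ?case by simp
next
  case (Suc n)
  from Suc.IH[OF Suc_leD[OF Suc.prems(1)]] obtain v where v: "inj_on v {..<n}" "v ` {..<n} \<subseteq> D"
    "\<forall>j<n. \<forall>x\<in>D - v ` {..<n}. x \<noteq> c j \<and> w x (c j) \<le> w x (v j)"
    using Suc.prems(2) less_Suc_eq by auto
  let ?R = "D - v ` {..<n}"
  have "card (v ` {..<n}) = n" using v(1) by (simp add: card_image)
  then have "v ` {..<n} \<noteq> D" using Suc.prems(1) by force
  then have R: "?R \<noteq> {}" "finite ?R" using v(2) assms(1) by auto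
  have cn: "c n \<in> X" using Suc.prems(2) by simp
  have "\<exists>u\<in>?R. \<forall>x\<in>?R - {u}. x \<noteq> c n \<and> w x (c n) \<le> w x u"
  proof (cases "c n \<in> ?R")
    case True
    then show ?thesis by (intro bexI[of _ "c n"]) auto
  next
    case False
    have "Max (w (c n) ` ?R) \<in> w (c n) ` ?R" using R by (intro Max_in) auto
    then obtain u where u: "u \<in> ?R" "w (c n) u = Max (w (c n) ` ?R)" by auto
    have "x \<noteq> c n \<and> w x (c n) \<le> w x u" if x: "x \<in> ?R - {u}" for x
    proof -
      have "w (c n) x \<le> w (c n) u" unfolding u(2) using R x by (intro Max_ge) auto
      \<comment> \<open>By the choice of \<open>u\<close>, the minimum on the left is
        \<open>w x (c n)\<close>.\<close>
      moreover have "min (w x (c n)) (w (c n) u) \<le> w x u"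
        using x u(1) False cn assms(2) by (intro ultra) auto
      ultimately show ?thesis using x False sym[of x "c n"] by auto
    qed
    with u(1) show ?thesis by blast
  qed
  then obtain u where u: "u \<in> ?R" "\<And>x. x \<in> ?R - {u} \<Longrightarrow> x \<noteq> c n \<and> w x (c n) \<le> w x u"
    by blast
  let ?v = "v(n := u)"
  have im: "?v ` {..<Suc n} = insert u (v ` {..<n})" by (auto simp: lessThan_Suc)
  have "inj_on ?v {..<Suc n}" using v(1) u(1)
    by (auto simp: inj_on_def less_Suc_eq image_iff)
  moreover have "?v ` {..<Suc n} \<subseteq> D" unfolding im using v(2) u(1) by auto
  moreover have "x \<noteq> c j \<and> w x (c j) \<le> w x (?v j)"
    if "j < Suc n" "x \<in> D - ?v ` {..<Suc n}" for j x
    using that v(3) u(2)[of x] unfolding im by (cases "j = n") auto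
  ultimately show ?case by blast
qed

text \<open>The bound \<open>opt\<close> is the induction hypothesis of
  \<open>greedy_seq_minimizes_energy\<close>, kept as an assumption so that the same argument serves
  inside that induction and, once it is complete, for \<open>exists_cheap_extension\<close>.\<close>

lemma cheap_extension:
  assumes "greedy_seq X w n c" "D \<subseteq> X" "card D = Suc n"
    and opt: "\<And>D. D \<subseteq> X \<Longrightarrow> card D = n \<Longrightarrow> 2 * (\<Sum>k<n. history_sum w c k (c k)) \<le> energy w D"
  shows "\<exists>x\<in>D - c ` {..<n}.
    2 * (\<Sum>k<n. history_sum w c k (c k)) + 2 * history_sum w c n x \<le> energy w D"
proof -
  have fin: "finite D" using assms(3) by (simp add: card_ge_0_finite)
  obtain v where v: "inj_on v {..<n}" "v ` {..<n} \<subseteq> D"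
    "\<And>j x. j < n \<Longrightarrow> x \<in> D - v ` {..<n} \<Longrightarrow> x \<noteq> c j \<and> w x (c j) \<le> w x (v j)"
    using successive_projections[of D n c] fin assms(2,3) greedy_seq_mem[OF assms(1)] by auto
  have card_v: "card (v ` {..<n}) = n" using v(1) by (simp add: card_image)
  then have "v ` {..<n} \<noteq> D" using assms(3) by force
  then obtain x where x: "x \<in> D" "x \<notin> v ` {..<n}" using v(2) by auto
  have "card (insert x (v ` {..<n})) = card D" using x card_v assms(3) by simp
  then have D: "D = insert x (v ` {..<n})"
    using x v(2) fin by (intro card_subset_eq[symmetric]) auto
  have "history_sum w c n x \<le> (\<Sum>j<n. w x (v j))"
    unfolding history_sum_def using v(3) x by (intro sum_mono) auto
  also have "\<dots> = (\<Sum>y\<in>v ` {..<n}. w x y)" using v(1) by (simp add: sum.reindex)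
  finally have "2 * history_sum w c n x + energy w (v ` {..<n}) \<le> energy w D"
    unfolding D using energy_insert[of "v ` {..<n}" x w] x sym by simp
  moreover have "2 * (\<Sum>k<n. history_sum w c k (c k)) \<le> energy w (v ` {..<n})"
    using v(2) assms(2) card_v by (intro opt) auto
  \<comment> \<open>A term \<open>c j\<close> that lies in \<open>D\<close> is matched with itself
    unless it was matched before, so the unmatched element is not in the history.\<close>
  moreover have "x \<in> D - c ` {..<n}" using x v(3) by blast
  ultimately show ?thesis by (intro bexI[of _ x]) auto
qed

text \<open>The left-over element is a legitimate competitor of the next greedy choice, which
  therefore costs no more than it does.\<close>

lemma greedy_seq_minimizes_energy:
  assumes "greedy_seq X w n c" "D \<subseteq> X" "card D = n"
  shows "2 * (\<Sum>k<n. history_sum w c k (c k)) \<le> energy w D"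
  using assms
proof (induction n arbitrary: D)
  case 0
  \<comment> \<open>\<open>card D = 0\<close> also admits an infinite \<open>D\<close>, whose energy
    is 0 by the default value of \<open>sum\<close>.\<close>
  then show ?case by (cases "finite D") (auto simp: energy_def)
next
  case (Suc n)
  have g: "greedy_seq X w n c" using greedy_seq_mono[OF Suc.prems(1)] by simp
  obtain x where x: "x \<in> D - c ` {..<n}"
    "2 * (\<Sum>k<n. history_sum w c k (c k)) + 2 * history_sum w c n x \<le> energy w D"
    using cheap_extension[OF g Suc.prems(2,3) Suc.IH[OF g]] by blast
  have "history_sum w c n (c n) \<le> history_sum w c n x"
    using Suc.prems(1,2) x(1) by (auto simp: greedy_seq_def is_arg_min_linorder)
  with x(2) show ?case by simp
qed

lemma exists_cheap_extension:
  assumes "greedy_seq X w n c" "D \<subseteq> X" "card D = Suc n"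
  shows "\<exists>x\<in>D - c ` {..<n}.
    2 * (\<Sum>k<n. history_sum w c k (c k)) + 2 * history_sum w c n x \<le> energy w D"
  using cheap_extension[OF assms] greedy_seq_minimizes_energy[OF assms(1)] by blast

end

section \<open>Comparison of two spaces that embed into each other\<close>

definition pairing_embedding ::
  "'a set \<Rightarrow> ('a \<Rightarrow> 'a \<Rightarrow> real) \<Rightarrow> 'b set \<Rightarrow> ('b \<Rightarrow> 'b \<Rightarrow> real) \<Rightarrow> ('a \<Rightarrow> 'b) \<Rightarrow> bool" where
  "pairing_embedding X w X' w' G \<longleftrightarrow> inj_on G X \<and> G ` X \<subseteq> X' \<and>
     (\<forall>x\<in>X. \<forall>y\<in>X. x \<noteq> y \<longrightarrow> w' (G x) (G y) = w x y)"

lemma pairing_embedding_subset: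
  assumes "pairing_embedding X w X' w' G" "D \<subseteq> X"
  shows "G ` D \<subseteq> X'" "card (G ` D) = card D" "energy w' (G ` D) = energy w D"
proof -
  have "inj_on G D" using assms by (auto simp: pairing_embedding_def intro: inj_on_subset)
  then show "card (G ` D) = card D" by (rule card_image)
  show "energy w' (G ` D) = energy w D" using \<open>inj_on G D\<close>
    by (rule energy_image) (use assms in \<open>auto simp: pairing_embedding_def subset_iff\<close>)
  show "G ` D \<subseteq> X'" using assms by (auto simp: pairing_embedding_def)
qed

text \<open>The image of the set chosen in \<open>X\<close> competes, with unchanged energy, against
  the greedy sequence of \<open>X'\<close>. Embeddings in both directions thus equate the totals
  without a bijection between \<open>X\<close> and \<open>X'\<close>.\<close>

lemma greedy_total_le:
  assumes "ultrametric_pairing X w" "ultrametric_pairing X' w'" "pairing_embedding X w X' w' G"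
    "greedy_seq X w n c" "greedy_seq X' w' n c'"
  shows "(\<Sum>k<n. history_sum w' c' k (c' k)) \<le> (\<Sum>k<n. history_sum w c k (c k))"
proof -
  have inj: "inj_on c {..<n}" and X: "c ` {..<n} \<subseteq> X"
    using greedy_seq_inj[OF assms(4)] greedy_seq_mem[OF assms(4)] by auto
  have "2 * (\<Sum>k<n. history_sum w' c' k (c' k)) \<le> energy w' (G ` c ` {..<n})"
    using pairing_embedding_subset[OF assms(3) X] inj
    by (intro ultrametric_pairing.greedy_seq_minimizes_energy[OF assms(2,5)])
       (auto simp: card_image)
  also have "\<dots> = 2 * (\<Sum>k<n. history_sum w c k (c k))"
    using pairing_embedding_subset(3)[OF assms(3) X]
      energy_image_lessThan[OF inj ultrametric_pairing.sym[OF assms(1)]] by simp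
  finally show ?thesis by simp
qed

lemma greedy_total_eq:
  assumes "ultrametric_pairing X w" "ultrametric_pairing X' w'"
    "pairing_embedding X w X' w' G" "pairing_embedding X' w' X w G'"
    "greedy_seq X w n c" "greedy_seq X' w' n c'"
  shows "(\<Sum>k<n. history_sum w' c' k (c' k)) = (\<Sum>k<n. history_sum w c k (c k))"
  using greedy_total_le[of X w X' w'] greedy_total_le[of X' w' X w] assms by (meson order_antisym)

lemma greedy_value_eq:
  assumes "ultrametric_pairing X w" "ultrametric_pairing X' w'"
    "pairing_embedding X w X' w' G" "pairing_embedding X' w' X w G'"
    "greedy_seq X w (Suc n) c" "greedy_seq X' w' (Suc n) c'"
  shows "history_sum w' c' n (c' n) = history_sum w c n (c n)"
  using greedy_total_eq[OF assms]
    greedy_total_eq[OF assms(1-4) greedy_seq_mono[OF assms(5)] greedy_seq_mono[OF assms(6)], of n]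
  by simp

text \<open>The minimum is attained although no compactness is available: the longer sequence in \<open>X'\<close>
  yields an element of \<open>X\<close> that attains it.\<close>

lemma greedy_seq_extends:
  assumes "ultrametric_pairing X w" "ultrametric_pairing X' w'"
    "pairing_embedding X w X' w' G" "pairing_embedding X' w' X w G'"
    "greedy_seq X w n c" "greedy_seq X' w' (Suc n) c'"
  shows "\<exists>x. is_arg_min (history_sum w c n) (\<lambda>x. x \<in> X - c ` {..<n}) x"
proof -
  interpret X: ultrametric_pairing X w by fact
  interpret X': ultrametric_pairing X' w' by fact
  let ?A = "\<Sum>k<n. history_sum w c k (c k)"
  let ?A' = "\<Sum>k<Suc n. history_sum w' c' k (c' k)"
  have inj': "inj_on c' {..<Suc n}" and X': "c' ` {..<Suc n} \<subseteq> X'"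
    using greedy_seq_inj[OF assms(6)] greedy_seq_mem[OF assms(6)] by auto
  note G' = pairing_embedding_subset[OF assms(4) X']
  \<comment> \<open>The \<open>n + 1\<close> elements chosen in \<open>X'\<close> are pulled back to
    \<open>X\<close>; what the history of \<open>c\<close> leaves unmatched among them is the
    candidate.\<close>
  obtain x where x: "x \<in> G' ` c' ` {..<Suc n} - c ` {..<n}"
    "2 * ?A + 2 * history_sum w c n x \<le> energy w (G' ` c' ` {..<Suc n})"
    using X.exists_cheap_extension[OF assms(5) G'(1)] G'(2) inj' by (auto simp: card_image)
  have xA: "2 * ?A + 2 * history_sum w c n x \<le> 2 * ?A'"
    using x(2) G'(3) energy_image_lessThan[OF inj' X'.sym] by simp
  have inj: "inj_on c {..<n}" and X: "c ` {..<n} \<subseteq> X"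
    using greedy_seq_inj[OF assms(5)] greedy_seq_mem[OF assms(5)] by auto
  \<comment> \<open>Any competitor \<open>y\<close> completes the history to a set of
    \<open>n + 1\<close> elements, whose image in \<open>X'\<close> has energy at least
    \<open>2 * ?A'\<close>.\<close>
  have "2 * ?A' \<le> 2 * ?A + 2 * history_sum w c n y" if y: "y \<in> X - c ` {..<n}" for y
  proof -
    let ?D = "insert y (c ` {..<n})"
    have D: "?D \<subseteq> X" using X y by auto
    note G = pairing_embedding_subset[OF assms(3) D]
    have "card ?D = Suc n" using y inj by (simp add: card_image)
    then have "2 * ?A' \<le> energy w' (G ` ?D)"
      using G by (intro X'.greedy_seq_minimizes_energy[OF assms(6)]) auto
    also have "\<dots> = energy w (c ` {..<n}) + 2 * (\<Sum>z\<in>c ` {..<n}. w y z)"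
      using G(3) energy_insert[of "c ` {..<n}" y w] y X.sym by simp
    also have "energy w (c ` {..<n}) = 2 * ?A" by (rule energy_image_lessThan[OF inj X.sym])
    also have "(\<Sum>z\<in>c ` {..<n}. w y z) = history_sum w c n y"
      using inj by (simp add: sum.reindex history_sum_def)
    finally show ?thesis .
  qed
  then have "history_sum w c n x \<le> history_sum w c n y" if "y \<in> X - c ` {..<n}" for y
    using xA that by force
  moreover have "x \<in> X - c ` {..<n}" using x(1) G'(1) by auto
  ultimately show ?thesis by (auto simp: is_arg_min_linorder)
qed

section \<open>Ancestor edges in a rooted tree\<close>

lemma oriented_path_snoc:
  "oriented_path T u p v \<Longrightarrow> (v, w) \<in> tedges T \<Longrightarrow> w \<in> tverts T \<Longrightarrow>
    oriented_path T u (p @ [w]) w"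
  by (auto simp: oriented_path_def successively_append_iff)

lemma path_edges_snoc:
  "p \<noteq> [] \<Longrightarrow>
    path_edges (Leaf_Path (p @ [w])) = insert (last p, w) (path_edges (Leaf_Path p))"
proof (induction p rule: list_nonempty_induct)
  case (cons x xs)
  then show ?case by (cases xs) auto
qed simp

locale arborescence =
  fixes T :: "'v rtree"
  assumes rooted: "rooted_tree T"
begin

abbreviation "V \<equiv> tverts T"
abbreviation "E \<equiv> tedges T"
abbreviation "rt \<equiv> troot T"

definition root_path :: "'v \<Rightarrow> 'v list" where
  "root_path v = (THE p. oriented_path T rt p v)"

text \<open>\<open>Leaf_Path\<close> only serves as a wrapper for a list of vertices;
  \<open>v\<close> need not be a leaf. Inclusion between these sets encodes the ancestor order of
  vertices.\<close>

definition up_edges :: "'v \<Rightarrow> ('v \<times> 'v) set" where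
  "up_edges v = path_edges (Leaf_Path (root_path v))"

lemma root_in_V: "rt \<in> V"
  using rooted by (simp add: rooted_tree_def)

lemma edge_in_V: "(u, v) \<in> E \<Longrightarrow> u \<in> V" "(u, v) \<in> E \<Longrightarrow> v \<in> V"
  using rooted by (auto simp: rooted_tree_def)

lemma oriented_path_root_path: "v \<in> V \<Longrightarrow> oriented_path T rt (root_path v) v"
  using rooted theI'[of "\<lambda>p. oriented_path T rt p v"] by (simp add: root_path_def rooted_tree_def)

lemma root_path_eq:
  assumes "oriented_path T rt p v"
  shows "root_path v = p"
proof -
  have "v \<in> V" using assms by (auto simp: oriented_path_def)
  then have "\<exists>!p. oriented_path T rt p v" using rooted by (simp add: rooted_tree_def)
  then show ?thesis unfolding root_path_def using assms by (rule the1_equality)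
qed

lemma root_path_root: "root_path rt = [rt]"
  by (rule root_path_eq) (simp add: oriented_path_def root_in_V)

lemma root_path_nonempty: "v \<in> V \<Longrightarrow> root_path v \<noteq> []"
  using oriented_path_root_path by (auto simp: oriented_path_def)

lemma last_root_path: "v \<in> V \<Longrightarrow> last (root_path v) = v"
  using oriented_path_root_path by (auto simp: oriented_path_def)

lemma root_path_edge: "(u, v) \<in> E \<Longrightarrow> root_path v = root_path u @ [v]"
  using edge_in_V oriented_path_root_path by (intro root_path_eq oriented_path_snoc) auto

text \<open>Deleting the last vertex of a root path leaves the root path of the parent, so induction
  on the path reaches every vertex.\<close>

lemma tree_induct [consumes 1, case_names root edge]:
  assumes "v \<in> V" and root: "P rt" and edge: "\<And>u v. (u, v) \<in> E \<Longrightarrow> P u \<Longrightarrow> P v"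
  shows "P v"
proof -
  have "P v" if "oriented_path T rt p v" for p v
    using that
  proof (induction p arbitrary: v rule: rev_induct)
    case Nil
    then show ?case by (simp add: oriented_path_def)
  next
    case (snoc w p)
    show ?case
    proof (cases "p = []")
      case True
      then show ?thesis using snoc.prems root by (auto simp: oriented_path_def)
    next
      case False
      then have "oriented_path T rt p (last p)" "(last p, w) \<in> E" "w = v"
        using snoc.prems by (auto simp: oriented_path_def successively_append_iff)
      then show ?thesis using snoc.IH edge by blast
    qed
  qed
  then show ?thesis using oriented_path_root_path[OF assms(1)] .
qed

lemma vertex_cases:
  assumes "v \<in> V"
  obtains "v = rt" | u where "(u, v) \<in> E"
proof -
  from assms have "v = rt \<or> (\<exists>u. (u, v) \<in> E)"
    by (cases rule: tree_induct) auto
  then show thesis using that by blast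
qed

lemma no_edge_into_root: "(u, rt) \<notin> E"
  using root_path_edge[of u rt] root_path_root root_path_nonempty edge_in_V by fastforce

lemma parent_unique: "(u, v) \<in> E \<Longrightarrow> (u', v) \<in> E \<Longrightarrow> u = u'"
  using root_path_edge[of u v] root_path_edge[of u' v] last_root_path edge_in_V
  by (metis append1_eq_conv)

text \<open>Vertices are counted, not edges: the root has level 1, and the vertex with index
  \<open>n\<close> on a ray has level \<open>Suc n\<close>.\<close>

definition level :: "'v \<Rightarrow> nat" where "level v = length (root_path v)"

lemma level_edge: "(u, v) \<in> E \<Longrightarrow> level v = Suc (level u)"
  by (simp add: level_def root_path_edge)

lemma up_edges_root [simp]: "up_edges rt = {}"
  by (simp add: up_edges_def root_path_root)

lemma up_edges_edge: "(u, v) \<in> E \<Longrightarrow> up_edges v = insert (u, v) (up_edges u)"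
  using path_edges_snoc[of "root_path u" v] root_path_nonempty edge_in_V last_root_path
  by (simp add: up_edges_def root_path_edge del: path_edges.simps)

lemma up_edges_snd: "e \<in> E \<Longrightarrow> up_edges (snd e) = insert e (up_edges (fst e))"
  using up_edges_edge[of "fst e" "snd e"] by simp

lemma finite_up_edges [simp]: "finite (up_edges v)"
  by (simp add: up_edges_def)

lemma up_edges_subset_E: "v \<in> V \<Longrightarrow> up_edges v \<subseteq> E"
  by (induction v rule: tree_induct) (auto simp: up_edges_edge)

lemma level_up_edges: "v \<in> V \<Longrightarrow> e \<in> up_edges v \<Longrightarrow> level (snd e) \<le> level v"
  by (induction v rule: tree_induct) (auto simp: up_edges_edge level_edge)

lemma up_edges_trans: "v \<in> V \<Longrightarrow> e \<in> up_edges v \<Longrightarrow> up_edges (snd e) \<subseteq> up_edges v"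
proof (induction v rule: tree_induct)
  case (edge u v)
  then show ?case by (cases "e = (u, v)") (auto simp: up_edges_edge)
qed simp

lemma edge_notin_up_edges_fst: "e \<in> E \<Longrightarrow> e \<notin> up_edges (fst e)"
  using level_up_edges[of "fst e" e] level_edge[of "fst e" "snd e"] edge_in_V(1)[of "fst e" "snd e"]
  by auto

lemma edge_in_up_edges_snd: "e \<in> E \<Longrightarrow> e \<in> up_edges (snd e)"
  by (simp add: up_edges_snd)

text \<open>For edges, \<open>e \<in> up_edges (snd e')\<close> is the reflexive ancestor order. It
  is linear above a vertex because passing to a child adds a single edge, below all the earlier
  ones.\<close>

lemma up_edges_chain:
  "v \<in> V \<Longrightarrow> e \<in> up_edges v \<Longrightarrow> e' \<in> up_edges v \<Longrightarrow>
    e \<in> up_edges (snd e') \<or> e' \<in> up_edges (snd e)"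
  by (induction v rule: tree_induct) (auto simp: up_edges_edge)

text \<open>The edge into \<open>v\<close> is the only member of \<open>up_edges v\<close> whose end
  has the greatest level, so the set determines \<open>v\<close>; the empty set belongs to the
  root.\<close>

lemma up_edges_inj:
  assumes "v \<in> V" "w \<in> V" "up_edges v = up_edges w"
  shows "v = w"
  using assms(1)
proof (cases rule: vertex_cases)
  case 1
  show ?thesis using assms(2)
  proof (cases rule: vertex_cases)
    case (2 u)
    then show ?thesis using assms(3) 1 by (simp add: up_edges_edge)
  qed (simp add: 1)
next
  case v: (2 u)
  show ?thesis using assms(2)
  proof (cases rule: vertex_cases)
    case 1
    then show ?thesis using assms(3) v by (simp add: up_edges_edge)
  next
    case (2 u')
    have "(u, v) \<in> up_edges w" "(u', w) \<in> up_edges v"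
      using assms(3) up_edges_edge[OF v] up_edges_edge[OF 2] by blast+
    then have "level v = level w"
      using level_up_edges[OF assms(1)] level_up_edges[OF assms(2)] by fastforce
    moreover have "(u, v) = (u', w) \<or> (u, v) \<in> up_edges u'"
      using \<open>(u, v) \<in> up_edges w\<close> up_edges_edge[OF 2] by blast
    ultimately show ?thesis
      using level_up_edges[of u' "(u, v)"] 2 level_edge edge_in_V by fastforce
  qed
qed

lemma exists_edge_towards:
  assumes "w \<in> V" "v \<in> V" "up_edges v \<subseteq> up_edges w" "v \<noteq> w"
  shows "\<exists>w'. (v, w') \<in> up_edges w"
  using assms
proof (induction w rule: tree_induct)
  case root
  then show ?case using up_edges_inj root_in_V by fastforce
next
  case (edge u w)
  show ?case
  proof (cases "v = u")
    case True
    then show ?thesis using edge by (auto simp: up_edges_edge)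
  next
    case False
    have "(u, w) \<notin> up_edges v"
      using up_edges_trans[of v "(u, w)"] up_edges_inj[of v w] edge edge_in_V by auto
    then show ?thesis using edge False by (auto simp: up_edges_edge)
  qed
qed

text \<open>A vertex other than the root has exactly one incoming edge, so valence one excludes
  outgoing edges. If the tree has a further vertex, the path to it leaves the root by an edge, so
  the criterion also covers the root.\<close>

lemma leaf_iff: "v \<in> leaves T \<longleftrightarrow> v \<in> V \<and> (\<forall>w. (v, w) \<notin> E)"
proof (cases "v = rt")
  case True
  have "\<exists>w. (rt, w) \<in> E" if w: "w \<in> V" "w \<noteq> rt" for w
    using exists_edge_towards[OF w(1) root_in_V] up_edges_subset_E[OF w(1)] w(2)
    by (metis empty_subsetI subsetD up_edges_root)
  moreover have "w \<noteq> rt" if "(rt, w) \<in> E" for w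
    using that no_edge_into_root by blast
  ultimately have "V = {rt} \<longleftrightarrow> (\<forall>w. (rt, w) \<notin> E)"
    using root_in_V edge_in_V by blast
  then show ?thesis using True root_in_V by (simp add: leaves_def)
next
  case False
  show ?thesis
  proof (cases "v \<in> V")
    case True
    then obtain u where u: "(u, v) \<in> E" using False vertex_cases by blast
    then have "incident_edges T v = insert (u, v) {e \<in> E. fst e = v}"
      using parent_unique by (auto simp: incident_edges_def)
    moreover have "(u, v) \<notin> {e \<in> E. fst e = v}"
      using level_edge[OF u] by auto
    moreover have "card (insert (u, v) A) = 1 \<longleftrightarrow> A = {}" if "(u, v) \<notin> A" for A
      using that by (auto simp: card_1_singleton_iff)
    ultimately have "card (incident_edges T v) = 1 \<longleftrightarrow> {e \<in> E. fst e = v} = {}"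
      by simp
    then show ?thesis using True False by (auto simp: leaves_def)
  qed (auto simp: leaves_def)
qed

subsection \<open>The edges of an element of the extended boundary\<close>

lemma up_edges_ray:
  assumes "x \<in> tree_boundary T"
  shows "x n \<in> V" "up_edges (x n) = (\<lambda>i. (x i, x (Suc i))) ` {..<n}" "level (x n) = Suc n"
proof (induction n)
  case 0
  { case 1 show ?case using assms root_in_V by (simp add: tree_boundary_def)
  next case 2 show ?case using assms by (simp add: tree_boundary_def)
  next case 3 show ?case using assms by (simp add: tree_boundary_def level_def root_path_root) }
next
  case (Suc n)
  have e: "(x n, x (Suc n)) \<in> E" using assms by (simp add: tree_boundary_def)
  { case 1 show ?case using e edge_in_V by blast
  next case 2 show ?case using Suc(2) e by (simp add: up_edges_edge lessThan_Suc)
  next case 3 show ?case using Suc(3) e by (simp add: level_edge) }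
qed

lemma path_edges_Ray: "x \<in> tree_boundary T \<Longrightarrow> path_edges (Ray x) = (\<Union>n. up_edges (x n))"
  by (auto simp: up_edges_ray)

lemma inj_ray_edges: "x \<in> tree_boundary T \<Longrightarrow> inj (\<lambda>n. (x n, x (Suc n)))"
  by (rule injI) (metis up_edges_ray(3) Pair_inject nat.inject)

lemma infinite_path_edges_Ray: "x \<in> tree_boundary T \<Longrightarrow> infinite (path_edges (Ray x))"
  using inj_ray_edges[of x] by (simp add: range_inj_infinite)

lemma ext_boundary_cases [consumes 1]:
  assumes "\<rho> \<in> ext_boundary T"
  obtains (Ray) x where "\<rho> = Ray x" "x \<in> tree_boundary T"
  | (Leaf) v where "v \<in> leaves T" "\<rho> = Leaf_Path (root_path v)" "path_edges \<rho> = up_edges v"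
      "v \<in> V" "last (root_path v) = v"
proof -
  from assms consider x where "\<rho> = Ray x" "x \<in> tree_boundary T"
    | p v where "\<rho> = Leaf_Path p" "v \<in> leaves T" "oriented_path T rt p v"
    by (auto simp: ext_boundary_def)
  then show thesis
  proof cases
    case 1
    then show ?thesis by (rule that(1))
  next
    case 2
    then have "p = root_path v" "v \<in> V" by (simp_all add: root_path_eq leaf_iff)
    then show ?thesis using that(2)[of v] 2 last_root_path by (simp add: up_edges_def)
  qed
qed

lemma Leaf_Path_in_ext_boundary:
  "v \<in> leaves T \<Longrightarrow> Leaf_Path (root_path v) \<in> ext_boundary T"
  using oriented_path_root_path leaf_iff unfolding ext_boundary_def by blast

lemma path_edges_subset_E: "\<rho> \<in> ext_boundary T \<Longrightarrow> path_edges \<rho> \<subseteq> E"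
  by (cases \<rho> rule: ext_boundary_cases) (auto simp: up_edges_subset_E tree_boundary_def subset_iff
      dest: subsetD[OF up_edges_subset_E])

lemma path_edges_closed:
  assumes "\<rho> \<in> ext_boundary T" "e \<in> path_edges \<rho>"
  shows "up_edges (snd e) \<subseteq> path_edges \<rho>"
  using assms(1)
proof (cases rule: ext_boundary_cases)
  case (Ray x)
  then obtain n where "e \<in> up_edges (x n)" using assms(2) path_edges_Ray by auto
  then show ?thesis using up_edges_trans[of "x n" e] up_edges_ray(1) Ray path_edges_Ray by auto
next
  case (Leaf v)
  then show ?thesis using assms(2) up_edges_trans by simp
qed

lemma path_edges_chain:
  assumes "\<rho> \<in> ext_boundary T" "e \<in> path_edges \<rho>" "e' \<in> path_edges \<rho>"
  shows "e \<in> up_edges (snd e') \<or> e' \<in> up_edges (snd e)"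
  using assms(1)
proof (cases rule: ext_boundary_cases)
  case (Ray x)
  then obtain i j where "e = (x i, x (Suc i))" "e' = (x j, x (Suc j))" using assms(2,3) by auto
  then have "e \<in> up_edges (x (Suc (max i j)))" "e' \<in> up_edges (x (Suc (max i j)))"
    unfolding up_edges_ray(2)[OF Ray(2)]
    by (simp_all add: less_Suc_eq_le image_eqI[where x = i] image_eqI[where x = j])
  then show ?thesis using up_edges_chain up_edges_ray(1)[OF Ray(2)] by blast
next
  case (Leaf v)
  then show ?thesis using assms(2,3) up_edges_chain by simp
qed

lemma path_edges_inj:
  assumes "\<rho> \<in> ext_boundary T" "\<tau> \<in> ext_boundary T" "path_edges \<rho> = path_edges \<tau>"
  shows "\<rho> = \<tau>"
  using assms(1)
proof (cases rule: ext_boundary_cases)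
  case x: (Ray x)
  from assms(2) show ?thesis
  proof (cases rule: ext_boundary_cases)
    case y: (Ray y)
    have "x n = y n" for n
    proof -
      have "(x n, x (Suc n)) \<in> path_edges (Ray y)" using assms(3) x y by auto
      then obtain m where "(x n, x (Suc n)) = (y m, y (Suc m))" by auto
      then show ?thesis
        using up_edges_ray(3)[OF x(2), of n] up_edges_ray(3)[OF y(2), of m] by auto
    qed
    then show ?thesis using x y by auto
  next
    case (Leaf v)
    then show ?thesis using assms(3) infinite_path_edges_Ray[OF x(2)] x(1) by (metis finite_up_edges)
  qed
next
  case v: (Leaf v)
  from assms(2) show ?thesis
  proof (cases rule: ext_boundary_cases)
    case y: (Ray y)
    then show ?thesis using assms(3) infinite_path_edges_Ray[OF y(2)] v by (metis finite_up_edges)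
  next
    case w: (Leaf w)
    then have "v = w" using assms(3) v(3,4) up_edges_inj[of v w] by simp
    then show ?thesis using v(2) w(2) by simp
  qed
qed

text \<open>An infinite intersection reaches beyond every edge of either path. As both edge sets are
  closed under ancestors, they then coincide, which leaves only the case of two equal rays.\<close>

lemma common_edges_finite:
  assumes "\<rho> \<in> ext_boundary T" "\<tau> \<in> ext_boundary T" "\<rho> \<noteq> \<tau> \<or> \<rho> \<notin> range Ray"
  shows "finite (path_edges \<rho> \<inter> path_edges \<tau>)"
proof (rule ccontr)
  assume inf: "infinite (path_edges \<rho> \<inter> path_edges \<tau>)"
  have sub: "path_edges \<rho> \<subseteq> path_edges \<tau>"
    if \<rho>: "\<rho> \<in> ext_boundary T" and \<tau>: "\<tau> \<in> ext_boundary T"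
      and inf: "infinite (path_edges \<rho> \<inter> path_edges \<tau>)" for \<rho> \<tau>
  proof
    fix e assume e: "e \<in> path_edges \<rho>"
    have "\<not> path_edges \<rho> \<inter> path_edges \<tau> \<subseteq> up_edges (snd e)"
      using inf finite_subset[OF _ finite_up_edges] by blast
    then obtain a where a: "a \<in> path_edges \<rho>" "a \<in> path_edges \<tau>" "a \<notin> up_edges (snd e)" by blast
    then have "e \<in> up_edges (snd a)" using path_edges_chain[OF \<rho> e] by blast
    then show "e \<in> path_edges \<tau>" using path_edges_closed[OF \<tau> a(2)] by blast
  qed
  have "path_edges \<rho> = path_edges \<tau>"
    using sub[OF assms(1,2)] sub[OF assms(2,1)] inf by (simp add: Int_commute subset_antisym)
  then have "\<rho> = \<tau>" by (rule path_edges_inj[OF assms(1,2)])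
  moreover have "infinite (path_edges \<rho>)" using inf by auto
  ultimately show False using assms(3) by (cases \<rho>) auto
qed

text \<open>The vertex is the branch point of the two paths: the end of a common edge of greatest
  level, or the root if there is no common edge.\<close>

lemma common_edges_up_edges:
  assumes "\<rho> \<in> ext_boundary T" "\<tau> \<in> ext_boundary T" "finite (path_edges \<rho> \<inter> path_edges \<tau>)"
  shows "\<exists>v\<in>V. up_edges v = path_edges \<rho> \<inter> path_edges \<tau>"
proof (cases "path_edges \<rho> \<inter> path_edges \<tau> = {}")
  case True
  then show ?thesis using root_in_V by force
next
  case False
  let ?F = "path_edges \<rho> \<inter> path_edges \<tau>"
  define m where "m = Max ((\<lambda>e. level (snd e)) ` ?F)"
  have "m \<in> (\<lambda>e. level (snd e)) ` ?F"
    unfolding m_def using False assms(3) by (intro Max_in) auto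
  then obtain a where a: "a \<in> ?F" "level (snd a) = m" by blast
  have E: "a \<in> E" using a path_edges_subset_E[OF assms(1)] by auto
  then have V: "snd a \<in> V" "fst a \<in> V" using edge_in_V[of "fst a" "snd a"] by auto
  have "e \<in> up_edges (snd a)" if e: "e \<in> ?F" for e
  proof -
    have eE: "e \<in> E" using e path_edges_subset_E[OF assms(1)] by auto
    have le: "level (snd e) \<le> level (snd a)"
      unfolding a(2) m_def using e assms(3) by (intro Max_ge) auto
    have "a = e" if "a \<in> up_edges (snd e)"
    proof (rule ccontr)
      assume "a \<noteq> e"
      then have "a \<in> up_edges (fst e)" using that eE by (auto simp: up_edges_snd)
      then show False
        using level_up_edges[of "fst e" a] level_edge[of "fst e" "snd e"] eE le
          edge_in_V(1)[of "fst e" "snd e"] by auto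
    qed
    then show ?thesis
      using path_edges_chain[OF assms(1), of a e] a e edge_in_up_edges_snd[OF E] by auto
  qed
  moreover have "up_edges (snd a) \<subseteq> ?F"
    using path_edges_closed[OF assms(1)] path_edges_closed[OF assms(2)] a by auto
  ultimately show ?thesis using V by blast
qed

end

section \<open>Edge coordinates on the metric realization\<close>

text \<open>The coordinates of a point record how much of each edge the segment from the root to the
  point covers. This embeds the realization isometrically into \<open>\<ell>\<^sup>1(E)\<close>, and the pointwise order
  of coordinates is metric betweenness with respect to the root.\<close>

locale metric_tree = arborescence T for T :: "'v rtree" +
  fixes l :: "'v \<times> 'v \<Rightarrow> real"
  assumes length: "length_function T l"
begin

abbreviation "\<Gamma> \<equiv> realization T l"

lemma length_pos: "e \<in> E \<Longrightarrow> 0 < l e"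
  using length by (simp add: length_function_def)

fun coord :: "'v point \<Rightarrow> 'v \<times> 'v \<Rightarrow> real" where
  "coord (Vertex v) = (\<lambda>a. if a \<in> up_edges v then l a else 0)"
| "coord (Interior e t) = (\<lambda>a. if a = e then t else if a \<in> up_edges (fst e) then l a else 0)"

definition supp :: "'v point \<Rightarrow> ('v \<times> 'v) set" where "supp x = {e. coord x e \<noteq> 0}"

definition height :: "'v point \<Rightarrow> real" where "height x = (\<Sum>e\<in>supp x. coord x e)"

lemma Vertex_in [simp]: "Vertex v \<in> \<Gamma> \<longleftrightarrow> v \<in> V"
  by (auto simp: realization_def)

lemma edge_ends_in_V: "e \<in> E \<Longrightarrow> fst e \<in> V" "e \<in> E \<Longrightarrow> snd e \<in> V"
  using edge_in_V[of "fst e" "snd e"] by simp_all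

lemma edge_point_in: "e \<in> E \<Longrightarrow> 0 \<le> t \<Longrightarrow> t \<le> l e \<Longrightarrow> edge_point l e t \<in> \<Gamma>"
  using edge_ends_in_V[of e] by (auto simp: edge_point_def realization_def simp del: split_paired_Ex)

lemma edge_point_end: "e \<in> E \<Longrightarrow> edge_point l e (l e) = Vertex (snd e)"
  using length_pos[of e] by (simp add: edge_point_def)

text \<open>One formula for the interior and both ends of an edge: moving along \<open>e\<close>
  alters the coordinate at \<open>e\<close> alone.\<close>

lemma coord_edge_point:
  assumes "e \<in> E" "0 \<le> t" "t \<le> l e"
  shows "coord (edge_point l e t) = (coord (Vertex (fst e)))(e := t)"
  using assms edge_notin_up_edges_fst[OF assms(1)] length_pos[OF assms(1)] up_edges_snd[OF assms(1)]
  by (auto simp: edge_point_def fun_eq_iff)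

declare coord.simps [simp del]

text \<open>A vertex other than the root is treated as the end of its incoming edge, so vertices and
  interior points need no separate treatment.\<close>

lemma point_cases:
  assumes "x \<in> \<Gamma>"
  obtains (root) "x = Vertex rt"
  | (edge) e t where "e \<in> E" "0 < t" "t \<le> l e" "x = edge_point l e t"
proof -
  from assms consider v where "v \<in> V" "x = Vertex v"
    | e t where "e \<in> E" "0 < t" "t < l e" "x = Interior e t"
    by (auto simp: realization_def)
  then show thesis
  proof cases
    case 1
    show ?thesis using 1(1)
    proof (cases rule: vertex_cases)
      case (2 u)
      then show ?thesis using edge[of "(u, v)" "l (u, v)"] 1 length_pos edge_point_end by simp
    qed (use root 1 in simp)
  next
    case 2
    then show ?thesis using edge[of e t] by (simp add: edge_point_def)
  qed
qed

lemma supp_Vertex [simp]: "v \<in> V \<Longrightarrow> supp (Vertex v) = up_edges v"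
  using up_edges_subset_E[of v] length_pos by (force simp: supp_def coord.simps)

lemma supp_edge_point:
  assumes "e \<in> E" "0 < t" "t \<le> l e"
  shows "supp (edge_point l e t) = up_edges (snd e)"
  using assms up_edges_subset_E[OF edge_ends_in_V(1)[OF assms(1)]] length_pos
  by (force simp: supp_def coord_edge_point up_edges_snd coord.simps)

lemma coord_notin_supp: "e \<notin> supp x \<Longrightarrow> coord x e = 0"
  by (simp add: supp_def)

lemma finite_supp: "x \<in> \<Gamma> \<Longrightarrow> finite (supp x)"
  by (cases x rule: point_cases) (simp_all add: root_in_V supp_edge_point)

lemma supp_subset_E: "x \<in> \<Gamma> \<Longrightarrow> supp x \<subseteq> E"
  by (cases x rule: point_cases)
    (simp_all add: root_in_V supp_edge_point up_edges_subset_E edge_ends_in_V)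

lemma coord_bounds:
  assumes "x \<in> \<Gamma>"
  shows "0 \<le> coord x e" "e \<in> E \<Longrightarrow> coord x e \<le> l e"
proof -
  have "0 \<le> coord x e \<and> (e \<in> E \<longrightarrow> coord x e \<le> l e)"
    using assms
  proof (cases x rule: point_cases)
    case root
    then show ?thesis using length_pos[of e] by (auto simp: coord.simps)
  next
    case (edge a t)
    then show ?thesis
      using length_pos[of e] up_edges_subset_E[OF edge_ends_in_V(1)[OF edge(1)]]
      by (auto simp: coord_edge_point coord.simps)
  qed
  then show "0 \<le> coord x e" "e \<in> E \<Longrightarrow> coord x e \<le> l e" by auto
qed

lemma coord_pos: "x \<in> \<Gamma> \<Longrightarrow> e \<in> supp x \<Longrightarrow> 0 < coord x e"
  using coord_bounds(1)[of x e] by (simp add: supp_def order_less_le)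

section \<open>The order given by coordinates\<close>

lemma supp_mono:
  assumes "x \<in> \<Gamma>" "coord x \<le> coord y"
  shows "supp x \<subseteq> supp y"
proof
  fix e assume "e \<in> supp x"
  then have "0 < coord y e" using coord_pos[OF assms(1), of e] le_funD[OF assms(2), of e] by linarith
  then show "e \<in> supp y" by (simp add: supp_def)
qed

text \<open>The coordinates of a vertex have their largest possible value on its ancestor edges, so
  only the supports matter.\<close>

lemma le_Vertex_iff:
  assumes "x \<in> \<Gamma>" "v \<in> V"
  shows "coord x \<le> coord (Vertex v) \<longleftrightarrow> supp x \<subseteq> up_edges v"
proof
  assume "coord x \<le> coord (Vertex v)"
  then show "supp x \<subseteq> up_edges v" using supp_mono[OF assms(1)] assms(2) by fastforce
next
  assume sub: "supp x \<subseteq> up_edges v"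
  have "coord x e \<le> coord (Vertex v) e" for e
    using sub coord_bounds(2)[OF assms(1), of e] up_edges_subset_E[OF assms(2)]
      coord_notin_supp[of e x] by (cases "e \<in> supp x") (auto simp: coord.simps)
  then show "coord x \<le> coord (Vertex v)" by (simp add: le_fun_def)
qed

lemma edge_point_mono:
  assumes "e \<in> E" "0 \<le> s" "s \<le> t" "t \<le> l e"
  shows "coord (edge_point l e s) \<le> coord (edge_point l e t)"
  using assms by (simp add: coord_edge_point le_fun_def)

lemma edge_start_le:
  assumes "e \<in> E" "0 \<le> t" "t \<le> l e"
  shows "coord (Vertex (fst e)) \<le> coord (edge_point l e t)"
  using edge_point_mono[of e 0 t] assms by (simp add: edge_point_def)

lemma edge_end_ge:
  assumes "e \<in> E" "0 \<le> t" "t \<le> l e"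
  shows "coord (edge_point l e t) \<le> coord (Vertex (snd e))"
  using edge_point_mono[of e t "l e"] assms edge_point_end by simp

lemma root_le: "x \<in> \<Gamma> \<Longrightarrow> coord (Vertex rt) \<le> coord x"
  using coord_bounds(1) by (auto simp: le_fun_def coord.simps)

text \<open>The support determines the edge that carries the point, and the coordinate at that edge
  is the position on it.\<close>

lemma coord_inj:
  assumes "x \<in> \<Gamma>" "y \<in> \<Gamma>" "coord x = coord y"
  shows "x = y"
proof -
  have supp: "supp x = supp y" using assms(3) by (simp add: supp_def)
  have nonempty: "supp (edge_point l e t) \<noteq> {}" if "e \<in> E" "0 < t" "t \<le> l e" for e t
    using that by (auto simp: supp_edge_point up_edges_snd)
  from assms(1) show ?thesis
  proof (cases x rule: point_cases)
    case x: root
    from assms(2) show ?thesis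
    proof (cases y rule: point_cases)
      case (edge e t)
      then show ?thesis using supp x nonempty[of e t] root_in_V by simp
    qed (use x in simp)
  next
    case x: (edge e t)
    from assms(2) show ?thesis
    proof (cases y rule: point_cases)
      case root
      then show ?thesis using supp x nonempty[of e t] root_in_V by simp
    next
      case y: (edge a s)
      have "up_edges (snd e) = up_edges (snd a)"
        using supp x y supp_edge_point by simp
      then have "snd e = snd a"
        using edge_ends_in_V(2)[OF x(1)] edge_ends_in_V(2)[OF y(1)] by (intro up_edges_inj)
      then have "e = a"
        using parent_unique[of "fst e" "snd e" "fst a"] x(1) y(1) by (metis prod.collapse)
      moreover have "coord x e = t" "coord y a = s" using x y by (simp_all add: coord_edge_point)
      ultimately have "t = s" using assms(3) by simp
      then show ?thesis using x(4) y(4) \<open>e = a\<close> by simp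
    qed
  qed
qed

text \<open>The alternative is decided by whether \<open>x\<close> covers a part of
  \<open>e\<close>. If it does, comparing levels shows that the edge carrying \<open>x\<close>
  cannot lie beyond \<open>e\<close>.\<close>

lemma le_edge_point_cases:
  assumes "x \<in> \<Gamma>" "e \<in> E" "0 \<le> t" "t \<le> l e" "coord x \<le> coord (edge_point l e t)"
  obtains (below) "coord x \<le> coord (Vertex (fst e))"
  | (on) s where "0 < s" "s \<le> t" "x = edge_point l e s"
proof (cases "e \<in> supp x")
  case False
  have "coord x a \<le> coord (Vertex (fst e)) a" for a
  proof (cases "a = e")
    case True
    then show ?thesis using False coord_notin_supp[of e x] length_pos[OF assms(2)] by (auto simp: coord.simps)
  next
    case False
    then show ?thesis using le_funD[OF assms(5), of a] coord_edge_point[OF assms(2-4)] by simp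
  qed
  then show ?thesis using below by (simp add: le_fun_def)
next
  case True
  from assms(1) show ?thesis
  proof (cases x rule: point_cases)
    case root
    then show ?thesis using True root_in_V by simp
  next
    case (edge a s)
    have "a \<in> supp (edge_point l e t)"
      using supp_mono[OF assms(1,5)] edge by (auto simp: supp_edge_point up_edges_snd)
    moreover have "supp (edge_point l e t) \<subseteq> up_edges (snd e)"
      using supp_mono[OF edge_point_in[OF assms(2-4)] edge_end_ge[OF assms(2-4)]]
        edge_ends_in_V(2)[OF assms(2)] by simp
    ultimately have "level (snd a) \<le> level (snd e)"
      using level_up_edges[OF edge_ends_in_V(2)[OF assms(2)]] by blast
    then have "e \<notin> up_edges (fst a)"
      using level_up_edges[of "fst a" e] level_edge[of "fst a" "snd a"] edge(1) edge_ends_in_V(1)[of a]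
      by auto
    then have "a = e" using True edge by (auto simp: supp_edge_point up_edges_snd)
    moreover have "s \<le> t"
      using le_funD[OF assms(5), of e] \<open>a = e\<close> edge assms(2-4) by (simp add: coord_edge_point)
    ultimately show ?thesis using edge on by simp
  qed
qed

lemma exists_Vertex_ge:
  assumes "x \<in> \<Gamma>"
  shows "\<exists>v\<in>V. coord x \<le> coord (Vertex v)"
  using assms
proof (cases x rule: point_cases)
  case (edge e t)
  then show ?thesis using edge_end_ge[of e t] edge_ends_in_V(2)[of e] by auto
qed (use root_in_V in blast)

lemma le_Vertex_chain:
  assumes "v \<in> V" "x \<in> \<Gamma>" "y \<in> \<Gamma>" "coord x \<le> coord (Vertex v)" "coord y \<le> coord (Vertex v)"
  shows "coord x \<le> coord y \<or> coord y \<le> coord x"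
  using assms(1,4,5)
proof (induction v rule: tree_induct)
  case root
  then have "coord x = coord y"
    using root_le assms(2,3) by (meson order_antisym order_trans)
  then show ?case by simp
next
  case (edge u v)
  let ?e = "(u, v)"
  note x = le_edge_point_cases[OF assms(2), of ?e "l ?e"]
  note y = le_edge_point_cases[OF assms(3), of ?e "l ?e"]
  have [simp]: "edge_point l ?e (l ?e) = Vertex v" "0 \<le> l ?e"
    using edge_point_end[OF edge(1)] length_pos[OF edge(1)] by simp_all
  note start = edge_start_le[OF edge(1)]
  show ?case
  proof (rule x)
    assume xu: "coord x \<le> coord (Vertex (fst ?e))"
    show ?thesis
    proof (rule y)
      assume "coord y \<le> coord (Vertex (fst ?e))"
      then show ?thesis using edge.IH xu by simp
    next
      fix s assume "0 < s" "s \<le> l ?e" "y = edge_point l ?e s"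
      then show ?thesis using start[of s] xu by auto
    qed (use edge in simp_all)
  next
    fix s assume s: "0 < s" "s \<le> l ?e" "x = edge_point l ?e s"
    show ?thesis
    proof (rule y)
      assume "coord y \<le> coord (Vertex (fst ?e))"
      then show ?thesis using start[of s] s by auto
    next
      fix s' assume "0 < s'" "s' \<le> l ?e" "y = edge_point l ?e s'"
      then show ?thesis using s edge_point_mono[OF edge(1)] by (cases "s \<le> s'") auto
    qed (use edge in simp_all)
  qed (use edge in simp_all)
qed

lemma down_chain:
  assumes "x \<in> \<Gamma>" "y \<in> \<Gamma>" "z \<in> \<Gamma>" "coord x \<le> coord z" "coord y \<le> coord z"
  shows "coord x \<le> coord y \<or> coord y \<le> coord x"
  using exists_Vertex_ge[OF assms(3)] le_Vertex_chain assms by (meson order_trans)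

text \<open>A point whose root segment has entered \<open>e\<close> is either still on
  \<open>e\<close> or beyond its end.\<close>

lemma supp_comparable:
  assumes "x \<in> \<Gamma>" "e \<in> supp x"
  shows "coord x \<le> coord (Vertex (snd e)) \<or> coord (Vertex (snd e)) \<le> coord x"
  using assms(1)
proof (cases x rule: point_cases)
  case root
  then show ?thesis using assms(2) root_in_V by simp
next
  case (edge a t)
  show ?thesis
  proof (cases "a = e")
    case True
    then show ?thesis using edge edge_end_ge[of e t] by simp
  next
    case False
    then have "e \<in> up_edges (fst a)" using assms(2) edge by (simp add: supp_edge_point up_edges_snd)
    then have "up_edges (snd e) \<subseteq> up_edges (fst a)"
      using up_edges_trans edge_ends_in_V edge(1) by blast
    moreover have "snd e \<in> V" using supp_subset_E[OF assms(1)] assms(2) edge_ends_in_V by blast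
    ultimately have "coord (Vertex (snd e)) \<le> coord (Vertex (fst a))"
      using edge(1) edge_ends_in_V by (subst le_Vertex_iff) simp_all
    then show ?thesis using edge_start_le[of a t] edge by auto
  qed
qed

lemma exists_edge_above:
  assumes "z \<in> \<Gamma>" "v \<in> V" "coord (Vertex v) \<le> coord z" "z \<noteq> Vertex v"
  shows "\<exists>w. (v, w) \<in> supp z"
  using assms(1)
proof (cases z rule: point_cases)
  case root
  then have "coord z = coord (Vertex v)" using assms root_le[of "Vertex v"] by simp
  then show ?thesis using coord_inj[of z "Vertex v"] assms by simp
next
  case (edge e t)
  have sub: "up_edges v \<subseteq> up_edges (snd e)"
    using supp_mono[OF _ assms(3)] assms(2) edge by (simp add: supp_edge_point)
  have "v \<noteq> snd e"
  proof
    assume v: "v = snd e"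
    then have "l e \<le> t"
      using le_funD[OF assms(3), of e] edge edge_in_up_edges_snd[OF edge(1)]
      by (simp add: coord_edge_point coord.simps)
    then have "t = l e" using edge by simp
    then show False using edge assms(4) edge_point_end v by simp
  qed
  then show ?thesis
    using exists_edge_towards[of "snd e" v] sub edge edge_ends_in_V assms(2)
    by (simp add: supp_edge_point)
qed

subsection \<open>The path metric\<close>

lemma height_eq_sum:
  assumes "finite F" "supp x \<subseteq> F"
  shows "height x = (\<Sum>e\<in>F. coord x e)"
  unfolding height_def using assms coord_notin_supp by (intro sum.mono_neutral_left) auto

lemma height_Vertex: "v \<in> V \<Longrightarrow> height (Vertex v) = (\<Sum>e\<in>up_edges v. l e)"
  by (simp add: height_def coord.simps)

lemma height_edge_point:
  assumes "e \<in> E" "0 \<le> t" "t \<le> l e"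
  shows "height (edge_point l e t) = height (Vertex (fst e)) + t"
proof -
  have "e \<notin> up_edges (fst e)" using assms(1) by (rule edge_notin_up_edges_fst)
  moreover have "supp (edge_point l e t) \<subseteq> insert e (up_edges (fst e))"
    using coord_edge_point[OF assms] by (auto simp: supp_def coord.simps split: if_splits)
  then have "height (edge_point l e t) = (\<Sum>a\<in>insert e (up_edges (fst e)). coord (edge_point l e t) a)"
    by (intro height_eq_sum) auto
  moreover have "(\<Sum>a\<in>up_edges (fst e). coord (edge_point l e t) a) = (\<Sum>a\<in>up_edges (fst e). l a)"
    using \<open>e \<notin> up_edges (fst e)\<close> by (intro sum.cong) (auto simp: coord_edge_point[OF assms] coord.simps)
  ultimately show ?thesis
    using assms edge_ends_in_V by (simp add: height_Vertex coord_edge_point[OF assms])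
qed

lemma height_mono:
  assumes "x \<in> \<Gamma>" "y \<in> \<Gamma>" "coord x \<le> coord y"
  shows "height x \<le> height y"
  unfolding height_eq_sum[OF finite_supp[OF assms(2)] supp_mono[OF assms(1,3)]] height_def[of y]
  by (rule sum_mono) (rule le_funD[OF assms(3)])

lemma realization_path_trans:
  assumes "realization_path T l y z d" "realization_path T l x y c"
  shows "realization_path T l x z (c + d)"
  using assms
proof (induction rule: realization_path.induct)
  case (segment e s d t)
  then show ?case
    using realization_path.segment[of T l x e s "c + d" t] by (simp add: add.assoc)
qed simp

lemma realization_path_segment:
  assumes "e \<in> E" "s \<in> {0..l e}" "t \<in> {0..l e}"
  shows "realization_path T l (edge_point l e s) (edge_point l e t) \<bar>s - t\<bar>"
  using realization_path.segment[of T l "edge_point l e s" e s 0 t]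
    realization_path.start[of "edge_point l e s" T l] edge_point_in assms by simp

lemma realization_path_sym: "realization_path T l x y c \<Longrightarrow> realization_path T l y x c"
proof (induction rule: realization_path.induct)
  case (segment e s c t)
  then show ?case
    using realization_path_trans[OF segment.IH realization_path_segment[of e t s]]
    by (simp add: abs_minus_commute add.commute)
qed (rule realization_path.start)

text \<open>A segment on \<open>e\<close> changes one coordinate, by exactly its length, so no path
  is shorter than the l1 distance. Sums over arbitrary finite sets \<open>F\<close> replace a sum
  over all edges.\<close>

lemma realization_path_l1_le:
  assumes "realization_path T l x y c" "finite F"
  shows "(\<Sum>e\<in>F. \<bar>coord x e - coord y e\<bar>) \<le> c"
  using assms(1)
proof (induction rule: realization_path.induct)
  case (segment e s c t)
  have "(\<Sum>a\<in>F. \<bar>coord x a - coord (edge_point l e t) a\<bar>)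
      \<le> (\<Sum>a\<in>F. \<bar>coord x a - coord (edge_point l e s) a\<bar> + (if a = e then \<bar>s - t\<bar> else 0))"
    using segment.hyps by (intro sum_mono) (auto simp: coord_edge_point)
  also have "\<dots> \<le> c + \<bar>s - t\<bar>"
    using segment.IH assms(2) by (cases "e \<in> F") (simp_all add: sum.distrib)
  finally show ?case .
qed simp

text \<open>The induction step of the next lemma, with its hypothesis as the assumption
  \<open>IH\<close>, so that it applies both to the end of an edge and to its interior
  points.\<close>

lemma realization_path_edge_point:
  assumes "e \<in> E" "0 \<le> t" "t \<le> l e" "x \<in> \<Gamma>" "coord x \<le> coord (edge_point l e t)"
    and IH: "coord x \<le> coord (Vertex (fst e)) \<Longrightarrow>
      realization_path T l x (Vertex (fst e)) (height (Vertex (fst e)) - height x)"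
  shows "realization_path T l x (edge_point l e t) (height (edge_point l e t) - height x)"
  using assms(4,1,2,3,5)
proof (cases rule: le_edge_point_cases)
  case below
  have "edge_point l e 0 = Vertex (fst e)" by (simp add: edge_point_def)
  then show ?thesis
    using realization_path.segment[of T l x e 0 _ t] IH[OF below] assms(1-3)
    by (fastforce simp: height_edge_point algebra_simps)
next
  case (on s)
  then show ?thesis
    using realization_path_segment[of e s t] assms(1-3) by (simp add: height_edge_point)
qed

lemma realization_path_le:
  assumes "x \<in> \<Gamma>" "y \<in> \<Gamma>" "coord x \<le> coord y"
  shows "realization_path T l x y (height y - height x)"
proof -
  have V: "realization_path T l x (Vertex v) (height (Vertex v) - height x)"
    if "v \<in> V" "coord x \<le> coord (Vertex v)" for v
    using that
  proof (induction v rule: tree_induct)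
    case root
    then have "coord x = coord (Vertex rt)" using root_le[OF assms(1)] by (rule order_antisym)
    then have "x = Vertex rt" using coord_inj assms(1) root_in_V by simp
    then show ?case using realization_path.start[OF assms(1)] by simp
  next
    case (edge u v)
    then show ?case
      using realization_path_edge_point[of "(u, v)" "l (u, v)" x] edge_point_end[of "(u, v)"]
        length_pos[of "(u, v)"] assms(1) by simp
  qed
  from assms(2) show ?thesis
  proof (cases y rule: point_cases)
    case root
    then show ?thesis using V[of rt] root_in_V assms(3) by simp
  next
    case (edge e t)
    then show ?thesis
      using realization_path_edge_point[of e t x] V[of "fst e"] assms edge_ends_in_V by simp
  qed
qed

lemma path_metric_l1_ge:
  assumes "x \<in> \<Gamma>" "y \<in> \<Gamma>" "finite F"
  shows "(\<Sum>e\<in>F. \<bar>coord x e - coord y e\<bar>) \<le> path_metric T l x y"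
  unfolding path_metric_def
proof (rule cInf_greatest)
  \<comment> \<open>Two points are always joined through the root, so the infimum is taken over a
    nonempty set.\<close>
  have "realization_path T l x (Vertex rt) (height x - height (Vertex rt))"
    "realization_path T l (Vertex rt) y (height y - height (Vertex rt))"
    using realization_path_le[of "Vertex rt"] assms root_le root_in_V realization_path_sym by auto
  then show "{c. realization_path T l x y c} \<noteq> {}" using realization_path_trans by blast
qed (use realization_path_l1_le assms(3) in blast)

text \<open>No coordinate decreases on the way up from \<open>x\<close> to \<open>y\<close>, so the
  ascending path attains the l1 lower bound.\<close>

lemma path_metric_le:
  assumes "x \<in> \<Gamma>" "y \<in> \<Gamma>" "coord x \<le> coord y"
  shows "path_metric T l x y = height y - height x"
proof (rule antisym)
  have "bdd_below {c. realization_path T l x y c}"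
    using realization_path_l1_le[of x y _ "{}"] by (intro bdd_belowI[of _ 0]) simp
  then show "path_metric T l x y \<le> height y - height x"
    unfolding path_metric_def using realization_path_le[OF assms] by (intro cInf_lower) simp_all
  have "height y - height x = (\<Sum>e\<in>supp y. coord y e - coord x e)"
    using height_eq_sum[OF finite_supp[OF assms(2)] supp_mono[OF assms(1,3)]]
    by (simp add: height_def[of y] sum_subtractf)
  also have "\<dots> \<le> (\<Sum>e\<in>supp y. \<bar>coord x e - coord y e\<bar>)" by (intro sum_mono) auto
  also have "\<dots> \<le> path_metric T l x y" using assms finite_supp by (intro path_metric_l1_ge)
  finally show "height y - height x \<le> path_metric T l x y" .
qed

lemma path_metric_root: "x \<in> \<Gamma> \<Longrightarrow> path_metric T l (Vertex rt) x = height x"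
  using path_metric_le[of "Vertex rt" x] root_le root_in_V by (simp add: height_Vertex)

text \<open>Combined with the l1 bound, the equation makes the sum of the absolute differences at
  most the sum of the signed ones, so no difference is negative. The right-hand side mentions only
  the metric and the root, hence a rooted isometry preserves the order.\<close>

lemma le_iff_path_metric:
  assumes "x \<in> \<Gamma>" "y \<in> \<Gamma>"
  shows "coord x \<le> coord y \<longleftrightarrow>
    path_metric T l (Vertex rt) x + path_metric T l x y = path_metric T l (Vertex rt) y"
proof
  assume "coord x \<le> coord y"
  then show "path_metric T l (Vertex rt) x + path_metric T l x y = path_metric T l (Vertex rt) y"
    using assms by (simp add: path_metric_root path_metric_le)
next
  assume eq: "path_metric T l (Vertex rt) x + path_metric T l x y = path_metric T l (Vertex rt) y"
  let ?F = "supp x \<union> supp y"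
  \<comment> \<open>Twice the excess of \<open>coord x e\<close> over \<open>coord y e\<close>, or 0
    if there is none.\<close>
  let ?g = "\<lambda>e. \<bar>coord x e - coord y e\<bar> - (coord y e - coord x e)"
  have fin: "finite ?F" using assms finite_supp by blast
  have "(\<Sum>e\<in>?F. \<bar>coord x e - coord y e\<bar>) \<le> height y - height x"
    using path_metric_l1_ge[OF assms fin] eq assms by (simp add: path_metric_root)
  also have "\<dots> = (\<Sum>e\<in>?F. coord y e - coord x e)"
    using height_eq_sum[of ?F x] height_eq_sum[of ?F y] fin by (simp add: sum_subtractf)
  finally have "(\<Sum>e\<in>?F. ?g e) \<le> 0" by (simp add: sum_subtractf)
  moreover have "0 \<le> (\<Sum>e\<in>?F. ?g e)" by (intro sum_nonneg) auto
  ultimately have "\<forall>e\<in>?F. ?g e = 0"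
    using sum_nonneg_eq_0_iff[OF fin, of ?g] by auto
  then have "coord x e \<le> coord y e" for e
    using coord_notin_supp[of e x] coord_notin_supp[of e y] by (cases "e \<in> ?F") force+
  then show "coord x \<le> coord y" by (simp add: le_fun_def)
qed

end

section \<open>The extended boundary as the set of maximal chains\<close>

context metric_tree
begin

text \<open>One direction of the equivalence says that \<open>C\<close> is a chain, the other that
  no point can be added.\<close>

definition maximal_chain :: "'v point set \<Rightarrow> bool" where
  "maximal_chain C \<longleftrightarrow> C \<subseteq> \<Gamma> \<and>
     (\<forall>x\<in>\<Gamma>. x \<in> C \<longleftrightarrow> (\<forall>y\<in>C. coord x \<le> coord y \<or> coord y \<le> coord x))"

definition has_greatest :: "'v point set \<Rightarrow> bool" where
  "has_greatest C \<longleftrightarrow> (\<exists>m\<in>C. \<forall>x\<in>C. coord x \<le> coord m)"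

definition points :: "'v ext_path \<Rightarrow> 'v point set" where
  "points \<rho> = {x \<in> \<Gamma>. supp x \<subseteq> path_edges \<rho>}"

lemma points_le_Vertex:
  assumes "\<rho> \<in> ext_boundary T" "e \<in> path_edges \<rho>" "x \<in> \<Gamma>" "coord x \<le> coord (Vertex (snd e))"
  shows "x \<in> points \<rho>"
proof -
  have "snd e \<in> V" using path_edges_subset_E[OF assms(1)] assms(2) edge_ends_in_V by blast
  then show ?thesis
    using assms path_edges_closed[OF assms(1,2)] le_Vertex_iff[of x "snd e"] by (auto simp: points_def)
qed

lemma Vertex_in_points:
  assumes "\<rho> \<in> ext_boundary T" "e \<in> path_edges \<rho>"
  shows "Vertex (snd e) \<in> points \<rho>"
proof -
  have "snd e \<in> V" using path_edges_subset_E[OF assms(1)] assms(2) edge_ends_in_V by blast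
  then show ?thesis using points_le_Vertex[OF assms, of "Vertex (snd e)"] by simp
qed

lemma points_cases:
  assumes "x \<in> points \<rho>"
  obtains "x = Vertex rt" | e where "e \<in> path_edges \<rho>" "coord x \<le> coord (Vertex (snd e))"
proof -
  have x: "x \<in> \<Gamma>" "supp x \<subseteq> path_edges \<rho>" using assms by (auto simp: points_def)
  from x(1) show thesis
  proof (cases x rule: point_cases)
    case (edge e t)
    then have "e \<in> path_edges \<rho>" using x(2) by (auto simp: supp_edge_point up_edges_snd)
    then show ?thesis using that(2)[of e] edge edge_end_ge[of e t] by simp
  qed (rule that(1))
qed

lemma points_comparable:
  assumes \<rho>: "\<rho> \<in> ext_boundary T" and x: "x \<in> points \<rho>" and y: "y \<in> points \<rho>"
  shows "coord x \<le> coord y \<or> coord y \<le> coord x"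
proof -
  have \<Gamma>: "x \<in> \<Gamma>" "y \<in> \<Gamma>" using x y by (auto simp: points_def)
  from x show ?thesis
  proof (cases rule: points_cases)
    case 1
    then show ?thesis using root_le[OF \<Gamma>(2)] by simp
  next
    case e: (2 e)
    from y show ?thesis
    proof (cases rule: points_cases)
      case 1
      then show ?thesis using root_le[OF \<Gamma>(1)] by simp
    next
      case a: (2 a)
      have *: "coord (Vertex (snd e)) \<le> coord (Vertex (snd a))"
        if "e \<in> up_edges (snd a)" "e \<in> path_edges \<rho>" "a \<in> path_edges \<rho>" for e a
      proof -
        have V: "snd e \<in> V" "snd a \<in> V"
          using path_edges_subset_E[OF \<rho>] that edge_ends_in_V by blast+
        then show ?thesis
          using up_edges_trans[OF V(2) that(1)] le_Vertex_iff[of "Vertex (snd e)" "snd a"] by simp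
      qed
      have V: "snd e \<in> V" "snd a \<in> V"
        using path_edges_subset_E[OF \<rho>] e(1) a(1) edge_ends_in_V by blast+
      from path_edges_chain[OF \<rho> e(1) a(1)] show ?thesis
      proof
        assume "e \<in> up_edges (snd a)"
        then have "coord x \<le> coord (Vertex (snd a))" using *[of e a] e a by simp
        then show ?thesis using le_Vertex_chain[OF V(2) \<Gamma>] a by simp
      next
        assume "a \<in> up_edges (snd e)"
        then have "coord y \<le> coord (Vertex (snd e))" using *[of a e] e a by simp
        then show ?thesis using le_Vertex_chain[OF V(1) \<Gamma>] e by simp
      qed
    qed
  qed
qed

lemma leaf_maximal:
  assumes "v \<in> leaves T" "z \<in> \<Gamma>" "coord (Vertex v) \<le> coord z"
  shows "z = Vertex v"
proof (rule ccontr)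
  assume "z \<noteq> Vertex v"
  then obtain w where "(v, w) \<in> supp z"
    using exists_edge_above[OF assms(2) _ assms(3)] assms(1) leaf_iff by blast
  then show False using supp_subset_E[OF assms(2)] assms(1) leaf_iff by blast
qed

text \<open>A point off the path but comparable with all of it lies above every vertex of the path
  after the root. Its support is finite, which rules out a ray, and nothing lies strictly above a
  leaf.\<close>

lemma points_maximal:
  assumes \<rho>: "\<rho> \<in> ext_boundary T" and z: "z \<in> \<Gamma>"
    and comp: "\<And>x. x \<in> points \<rho> \<Longrightarrow> coord z \<le> coord x \<or> coord x \<le> coord z"
  shows "z \<in> points \<rho>"
proof (rule ccontr)
  assume notin: "z \<notin> points \<rho>"
  have below: "coord (Vertex (snd e)) \<le> coord z" if "e \<in> path_edges \<rho>" for e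
    using comp[OF Vertex_in_points[OF \<rho> that]] points_le_Vertex[OF \<rho> that z] notin by blast
  have sub: "path_edges \<rho> \<subseteq> supp z"
  proof
    fix e assume e: "e \<in> path_edges \<rho>"
    then have E: "e \<in> E" using path_edges_subset_E[OF \<rho>] by blast
    then show "e \<in> supp z"
      using supp_mono[OF _ below[OF e]] edge_ends_in_V(2)[OF E] edge_in_up_edges_snd[OF E] by auto
  qed
  from \<rho> show False
  proof (cases rule: ext_boundary_cases)
    case (Ray x)
    then show ?thesis
      using infinite_path_edges_Ray[of x] finite_subset[OF sub finite_supp[OF z]] by blast
  next
    case (Leaf v)
    have v: "Vertex v \<in> points \<rho>" using Leaf(3,4) by (simp add: points_def)
    have "\<not> coord z \<le> coord (Vertex v)"
      using notin z Leaf(3,4) le_Vertex_iff[of z v] by (simp add: points_def)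
    then have "z = Vertex v" using comp[OF v] leaf_maximal[OF Leaf(1) z] by blast
    then show ?thesis using v notin by simp
  qed
qed

lemma maximal_chain_points:
  assumes "\<rho> \<in> ext_boundary T"
  shows "maximal_chain (points \<rho>)"
  unfolding maximal_chain_def
proof (intro conjI ballI iffI)
  show "points \<rho> \<subseteq> \<Gamma>" by (auto simp: points_def)
next
  fix x y assume "x \<in> points \<rho>" "y \<in> points \<rho>"
  then show "coord x \<le> coord y \<or> coord y \<le> coord x" by (rule points_comparable[OF assms])
next
  fix x assume "x \<in> \<Gamma>" "\<forall>y\<in>points \<rho>. coord x \<le> coord y \<or> coord y \<le> coord x"
  then show "x \<in> points \<rho>" using points_maximal[OF assms] by blast
qed

section \<open>From maximal chains back to paths\<close>

lemma maximal_chain_comparable: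
  "maximal_chain C \<Longrightarrow> x \<in> C \<Longrightarrow> y \<in> C \<Longrightarrow> coord x \<le> coord y \<or> coord y \<le> coord x"
  unfolding maximal_chain_def by blast

lemma maximal_chain_memI:
  "maximal_chain C \<Longrightarrow> x \<in> \<Gamma> \<Longrightarrow>
    (\<And>y. y \<in> C \<Longrightarrow> coord x \<le> coord y \<or> coord y \<le> coord x) \<Longrightarrow> x \<in> C"
  unfolding maximal_chain_def by blast

lemma maximal_chain_subset: "maximal_chain C \<Longrightarrow> C \<subseteq> \<Gamma>"
  unfolding maximal_chain_def by blast

lemma maximal_chain_root:
  assumes C: "maximal_chain C"
  shows "Vertex rt \<in> C"
proof (rule maximal_chain_memI[OF C])
  fix y assume "y \<in> C"
  then have "y \<in> \<Gamma>" using maximal_chain_subset[OF C] by blast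
  then show "coord (Vertex rt) \<le> coord y \<or> coord y \<le> coord (Vertex rt)"
    by (simp add: root_le)
qed (simp add: root_in_V)

lemma maximal_chain_down:
  assumes C: "maximal_chain C" and x: "x \<in> C" and y: "y \<in> \<Gamma>" "coord y \<le> coord x"
  shows "y \<in> C"
proof (rule maximal_chain_memI[OF C y(1)])
  fix z assume z: "z \<in> C"
  have \<Gamma>: "x \<in> \<Gamma>" "z \<in> \<Gamma>" using C x z maximal_chain_subset by blast+
  from maximal_chain_comparable[OF C x z] show "coord y \<le> coord z \<or> coord z \<le> coord y"
    using down_chain[OF y(1) \<Gamma>(2,1) y(2)] y(2) by (blast intro: order_trans)
qed

text \<open>If \<open>C\<close> had nothing above \<open>v\<close>, any child of \<open>v\<close>
  could be added. Otherwise some point of \<open>C\<close> has entered an edge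
  \<open>(v, w)\<close>, and the end of that edge is comparable with all of
  \<open>C\<close>.\<close>

lemma maximal_chain_next_vertex:
  assumes C: "maximal_chain C" and v: "Vertex v \<in> C" "v \<notin> leaves T"
  shows "\<exists>w. (v, w) \<in> E \<and> Vertex w \<in> C"
proof -
  have V: "v \<in> V" using maximal_chain_subset[OF C] v(1) by auto
  have "\<exists>x\<in>C. x \<noteq> Vertex v \<and> coord (Vertex v) \<le> coord x"
  proof (rule ccontr)
    assume none: "\<not> (\<exists>x\<in>C. x \<noteq> Vertex v \<and> coord (Vertex v) \<le> coord x)"
    have top: "coord x \<le> coord (Vertex v)" if x: "x \<in> C" for x
    proof (cases "x = Vertex v")
      case False
      then have "\<not> coord (Vertex v) \<le> coord x" using none x by blast
      then show ?thesis using maximal_chain_comparable[OF C x v(1)] by simp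
    qed simp
    obtain w where w: "(v, w) \<in> E" using v(2) V leaf_iff by blast
    have vw: "coord (Vertex v) \<le> coord (Vertex w)"
      using edge_start_le[OF w, of "l (v, w)"] edge_point_end[OF w] length_pos[OF w] by simp
    have "Vertex w \<in> C"
    proof (rule maximal_chain_memI[OF C])
      show "Vertex w \<in> \<Gamma>" using edge_in_V(2)[OF w] by simp
      show "coord (Vertex w) \<le> coord y \<or> coord y \<le> coord (Vertex w)" if "y \<in> C" for y
        using order_trans[OF top[OF that] vw] by simp
    qed
    moreover have "w \<noteq> v" using level_edge[OF w] by auto
    ultimately show False using none vw by blast
  qed
  then obtain x where x: "x \<in> C" "x \<noteq> Vertex v" "coord (Vertex v) \<le> coord x" by blast
  have x\<Gamma>: "x \<in> \<Gamma>" using maximal_chain_subset[OF C] x(1) by blast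
  obtain w where w: "(v, w) \<in> supp x" using exists_edge_above[OF x\<Gamma> V x(3,2)] by blast
  then have E: "(v, w) \<in> E" using supp_subset_E[OF x\<Gamma>] by blast
  then have w\<Gamma>: "Vertex w \<in> \<Gamma>" using edge_in_V(2) by simp
  have "Vertex w \<in> C"
  proof (rule maximal_chain_memI[OF C w\<Gamma>])
    fix y assume y: "y \<in> C"
    have y\<Gamma>: "y \<in> \<Gamma>" using maximal_chain_subset[OF C] y by blast
    show "coord (Vertex w) \<le> coord y \<or> coord y \<le> coord (Vertex w)"
    proof (cases "(v, w) \<in> supp y")
      case True
      then show ?thesis using supp_comparable[OF y\<Gamma>, of "(v, w)"] by auto
    next
      case False
      then have "\<not> coord x \<le> coord y" using supp_mono[OF x\<Gamma>] w by blast
      then have "coord y \<le> coord x" using maximal_chain_comparable[OF C x(1) y] by blast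
      moreover have "coord x \<le> coord (Vertex w) \<or> coord (Vertex w) \<le> coord x"
        using supp_comparable[OF x\<Gamma> w] by simp
      ultimately show ?thesis
        using down_chain[OF w\<Gamma> y\<Gamma> x\<Gamma>] by (blast intro: order_trans)
    qed
  qed
  with E show ?thesis by blast
qed

text \<open>A chain without leaves can be followed from vertex to vertex forever, which gives a ray.
  Since \<open>points \<rho>\<close> is itself maximal, the inclusion in \<open>C\<close> already
  yields equality.\<close>

lemma maximal_chain_eq_points:
  assumes C: "maximal_chain C"
  shows "\<exists>\<rho>\<in>ext_boundary T. points \<rho> = C"
proof -
  have "\<exists>\<rho>\<in>ext_boundary T. points \<rho> \<subseteq> C"
  proof (cases "\<exists>v\<in>leaves T. Vertex v \<in> C")
    case True
    then obtain v where v: "v \<in> leaves T" "Vertex v \<in> C" by blast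
    let ?\<rho> = "Leaf_Path (root_path v)"
    have "v \<in> V" using v(1) leaf_iff by blast
    then have "points ?\<rho> \<subseteq> C"
      using maximal_chain_down[OF C v(2)] le_Vertex_iff[of _ v]
      by (auto simp: points_def up_edges_def[symmetric] simp del: path_edges.simps)
    then show ?thesis using Leaf_Path_in_ext_boundary[OF v(1)] by blast
  next
    case False
    \<comment> \<open>The clause for \<open>n = 0\<close> forces the chosen sequence to start at the
      root.\<close>
    let ?P = "\<lambda>n v. Vertex v \<in> C \<and> (n = (0::nat) \<longrightarrow> v = rt)"
    have "\<exists>x. \<forall>n. ?P n (x n) \<and> (x n, x (Suc n)) \<in> E"
    proof (rule dependent_nat_choice)
      show "\<exists>v. ?P 0 v" using maximal_chain_root[OF C] by blast
      show "\<exists>w. ?P (Suc n) w \<and> (v, w) \<in> E" if "?P n v" for v n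
        using maximal_chain_next_vertex[OF C, of v] that False by blast
    qed
    then obtain x where x: "\<And>n. Vertex (x n) \<in> C" "x 0 = rt" "\<And>n. (x n, x (Suc n)) \<in> E"
      by blast
    then have ray: "x \<in> tree_boundary T" by (simp add: tree_boundary_def)
    have "z \<in> C" if "z \<in> points (Ray x)" for z
      using that
    proof (cases rule: points_cases)
      case 1
      then show ?thesis using maximal_chain_root[OF C] by simp
    next
      case (2 e)
      then obtain n where "e = (x n, x (Suc n))" by auto
      then show ?thesis
        using maximal_chain_down[OF C x(1)[of "Suc n"]] that 2(2) by (simp add: points_def)
    qed
    then have "points (Ray x) \<subseteq> C" by blast
    moreover have "Ray x \<in> ext_boundary T" using ray by (simp add: ext_boundary_def)
    ultimately show ?thesis by blast
  qed
  then obtain \<rho> where \<rho>: "\<rho> \<in> ext_boundary T" "points \<rho> \<subseteq> C" by blast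
  have "C \<subseteq> points \<rho>"
  proof
    fix z assume z: "z \<in> C"
    then show "z \<in> points \<rho>"
      using \<rho> maximal_chain_comparable[OF C] maximal_chain_subset[OF C]
      by (intro points_maximal) blast+
  qed
  with \<rho> show ?thesis by blast
qed

section \<open>Boundary data read off the point sets\<close>

lemma points_inj:
  assumes "\<rho> \<in> ext_boundary T" "\<tau> \<in> ext_boundary T" "points \<rho> = points \<tau>"
  shows "\<rho> = \<tau>"
proof -
  have "path_edges \<rho> \<subseteq> path_edges \<tau>"
    if \<rho>: "\<rho> \<in> ext_boundary T" and eq: "points \<rho> = points \<tau>" for \<rho> \<tau>
  proof
    fix e assume e: "e \<in> path_edges \<rho>"
    have E: "e \<in> E" using path_edges_subset_E[OF \<rho>] e by blast
    have "Vertex (snd e) \<in> points \<tau>" using Vertex_in_points[OF \<rho> e] eq by simp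
    then have "up_edges (snd e) \<subseteq> path_edges \<tau>"
      using edge_ends_in_V(2)[OF E] by (simp add: points_def)
    then show "e \<in> path_edges \<tau>"
      using edge_in_up_edges_snd[OF E] edge_ends_in_V(2)[OF E] by auto
  qed
  from this[OF assms(1,3)] this[OF assms(2) assms(3)[symmetric]] show ?thesis
    by (intro path_edges_inj assms subset_antisym)
qed

lemma greatest_points_Leaf:
  assumes "v \<in> leaves T"
  shows "Vertex v \<in> points (Leaf_Path (root_path v))"
    "x \<in> points (Leaf_Path (root_path v)) \<Longrightarrow> coord x \<le> coord (Vertex v)"
  using assms le_Vertex_iff[of x v]
  by (auto simp: leaf_iff points_def up_edges_def[symmetric] simp del: path_edges.simps)

text \<open>A greatest point of a ray would have all its edges in a finite support. The argument
  counts edges, so it also covers rays of finite total length.\<close>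

lemma has_greatest_points_iff:
  assumes "\<rho> \<in> ext_boundary T"
  shows "has_greatest (points \<rho>) \<longleftrightarrow> \<rho> \<notin> range Ray"
  using assms
proof (cases rule: ext_boundary_cases)
  case (Ray x)
  have "\<not> has_greatest (points \<rho>)"
  proof
    assume "has_greatest (points \<rho>)"
    then obtain m where m: "m \<in> points \<rho>" "\<And>x. x \<in> points \<rho> \<Longrightarrow> coord x \<le> coord m"
      unfolding has_greatest_def by blast
    have "path_edges \<rho> \<subseteq> supp m"
    proof
      fix e assume e: "e \<in> path_edges \<rho>"
      then have E: "e \<in> E" using path_edges_subset_E[OF assms] by blast
      show "e \<in> supp m"
        using supp_mono[OF _ m(2)[OF Vertex_in_points[OF assms e]]]
          edge_ends_in_V(2)[OF E] edge_in_up_edges_snd[OF E] by auto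
    qed
    moreover have "m \<in> \<Gamma>" using m(1) by (simp add: points_def)
    ultimately show False
      using infinite_path_edges_Ray[OF Ray(2)] finite_subset[OF _ finite_supp] Ray(1) by blast
  qed
  then show ?thesis using Ray by simp
next
  case (Leaf v)
  then have "has_greatest (points \<rho>)"
    using greatest_points_Leaf[OF Leaf(1)] unfolding has_greatest_def by blast
  then show ?thesis using Leaf(2) by auto
qed

text \<open>The supremum is attained at the last common vertex of the two paths.\<close>

lemma pairing_eq_Sup_height:
  assumes "\<rho> \<in> ext_boundary T" "\<tau> \<in> ext_boundary T" "\<rho> \<noteq> \<tau> \<or> \<rho> \<notin> range Ray"
  shows "pairing l \<rho> \<tau> = Sup (height ` (points \<rho> \<inter> points \<tau>))"
proof -
  obtain v where v: "v \<in> V" "up_edges v = path_edges \<rho> \<inter> path_edges \<tau>"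
    using common_edges_up_edges[OF assms(1,2) common_edges_finite[OF assms]] by blast
  have "height x \<le> height (Vertex v)" if "x \<in> points \<rho> \<inter> points \<tau>" for x
    using that v le_Vertex_iff[of x v] by (intro height_mono) (auto simp: points_def)
  moreover have "Vertex v \<in> points \<rho> \<inter> points \<tau>" using v by (auto simp: points_def)
  ultimately have "Sup (height ` (points \<rho> \<inter> points \<tau>)) = height (Vertex v)"
    by (intro cSup_eq_maximum) auto
  then show ?thesis using v by (simp add: pairing_def height_Vertex)
qed

end

section \<open>Copies of leaves\<close>

text \<open>Replacing each leaf \<open>v\<close> by \<open>\<chi> v\<close> copies turns a greedy run into a greedy sequence without
  repetitions, since the pairing of two distinct copies of a leaf is the height of the leaf.\<close>

definition copies :: "'v rtree \<Rightarrow> ('v \<Rightarrow> enat) \<Rightarrow> ('v ext_path \<times> nat) set" where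
  "copies T \<chi> = {(\<tau>, i). \<tau> \<in> ext_boundary T \<and>
     (case \<tau> of Ray x \<Rightarrow> i = 0 | Leaf_Path p \<Rightarrow> enat i < \<chi> (last p))}"

definition copy_pairing ::
  "('v \<times> 'v \<Rightarrow> real) \<Rightarrow> 'v ext_path \<times> nat \<Rightarrow> 'v ext_path \<times> nat \<Rightarrow> real" where
  "copy_pairing l a b = pairing l (fst a) (fst b)"

definition multiplicity :: "(nat \<Rightarrow> 'v ext_path) \<Rightarrow> nat \<Rightarrow> 'v ext_path \<Rightarrow> nat" where
  "multiplicity \<rho> n \<tau> = card {j. j < n \<and> \<rho> j = \<tau>}"

text \<open>Numbering each choice by its earlier uses consumes the copies of a leaf in the order 0,
  1, 2, and so on, so the used copies always form an initial segment.\<close>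

definition copy_seq :: "(nat \<Rightarrow> 'v ext_path) \<Rightarrow> nat \<Rightarrow> 'v ext_path \<times> nat" where
  "copy_seq \<rho> n = (\<rho> n, multiplicity \<rho> n (\<rho> n))"

lemma multiplicity_Suc:
  "multiplicity \<rho> (Suc n) \<tau> = multiplicity \<rho> n \<tau> + (if \<rho> n = \<tau> then 1 else 0)"
proof -
  have "{j. j < Suc n \<and> \<rho> j = \<tau>} = {j. j < n \<and> \<rho> j = \<tau>} \<union> (if \<rho> n = \<tau> then {n} else {})"
    by (auto simp: less_Suc_eq)
  then show ?thesis by (simp add: multiplicity_def card_insert_if)
qed

lemma copy_seq_image: "(\<tau>, i) \<in> copy_seq \<rho> ` {..<n} \<longleftrightarrow> i < multiplicity \<rho> n \<tau>"
  by (induction n)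
    (auto simp: multiplicity_Suc lessThan_Suc copy_seq_def less_Suc_eq, auto simp: multiplicity_def)

lemma multiplicity_eq_0_iff: "multiplicity \<rho> n \<tau> = 0 \<longleftrightarrow> \<tau> \<notin> \<rho> ` {..<n}"
  by (auto simp: multiplicity_def)

lemma admissible_imp_copy:
  "admissible T \<chi> \<rho> n \<tau> \<Longrightarrow> (\<tau>, multiplicity \<rho> n \<tau>) \<in> copies T \<chi> - copy_seq \<rho> ` {..<n}"
  using multiplicity_eq_0_iff[of \<rho> n \<tau>]
  by (auto simp: copy_seq_image admissible_def copies_def multiplicity_def split: ext_path.splits)

lemma copy_imp_admissible:
  assumes "(\<tau>, i) \<in> copies T \<chi> - copy_seq \<rho> ` {..<n}"
  shows "admissible T \<chi> \<rho> n \<tau>"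
proof -
  have "multiplicity \<rho> n \<tau> \<le> i" using assms copy_seq_image[of \<tau> i \<rho> n] by auto
  then have "enat (multiplicity \<rho> n \<tau>) < c" if "enat i < c" for c
    using that by (metis enat_ord_simps(1) order_le_less_trans)
  then show ?thesis
    using assms \<open>multiplicity \<rho> n \<tau> \<le> i\<close> multiplicity_eq_0_iff[of \<rho> n \<tau>]
    by (auto simp: admissible_def copies_def multiplicity_def[symmetric] split: ext_path.splits)
qed

lemma history_sum_copies:
  "history_sum (copy_pairing l) (copy_seq \<rho>) n (\<tau>, i) = greedy_sum l \<rho> n \<tau>"
  by (simp add: history_sum_def greedy_sum_def copy_pairing_def copy_seq_def)

lemma greedy_choice_iff_copies:
  "greedy_choice T l \<chi> \<rho> n \<tau> \<longleftrightarrow>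
    (\<exists>i. is_arg_min (history_sum (copy_pairing l) (copy_seq \<rho>) n)
      (\<lambda>x. x \<in> copies T \<chi> - copy_seq \<rho> ` {..<n}) (\<tau>, i))"
proof -
  let ?R = "copies T \<chi> - copy_seq \<rho> ` {..<n}"
  have adm: "admissible T \<chi> \<rho> n \<sigma> \<longleftrightarrow> (\<exists>i. (\<sigma>, i) \<in> ?R)" for \<sigma>
    using admissible_imp_copy copy_imp_admissible by metis
  then have "(\<forall>\<sigma>. admissible T \<chi> \<rho> n \<sigma> \<longrightarrow> greedy_sum l \<rho> n \<tau> \<le> greedy_sum l \<rho> n \<sigma>) \<longleftrightarrow>
    (\<forall>\<sigma> i. (\<sigma>, i) \<in> ?R \<longrightarrow> greedy_sum l \<rho> n \<tau> \<le> greedy_sum l \<rho> n \<sigma>)"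
    by metis
  then show ?thesis
    by (simp add: greedy_choice_def is_arg_min_linorder history_sum_copies adm split_paired_All
        del: Diff_iff)
qed

text \<open>The index \<open>i\<close> of the minimizing copy is arbitrary, but the cost ignores it,
  so the next copy in order is a minimizer as well.\<close>

lemma greedy_choice_copy_seq:
  assumes "greedy_choice T l \<chi> \<rho> n (\<rho> n)"
  shows "is_arg_min (history_sum (copy_pairing l) (copy_seq \<rho>) n)
    (\<lambda>x. x \<in> copies T \<chi> - copy_seq \<rho> ` {..<n}) (copy_seq \<rho> n)"
proof -
  obtain i where "is_arg_min (history_sum (copy_pairing l) (copy_seq \<rho>) n)
      (\<lambda>x. x \<in> copies T \<chi> - copy_seq \<rho> ` {..<n}) (\<rho> n, i)"
    using assms greedy_choice_iff_copies by blast
  moreover have "copy_seq \<rho> n \<in> copies T \<chi> - copy_seq \<rho> ` {..<n}"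
    using admissible_imp_copy assms
    unfolding copy_seq_def greedy_choice_def is_arg_min_def by blast
  ultimately show ?thesis by (simp add: is_arg_min_def copy_seq_def history_sum_copies)
qed

lemma greedy_run_imp_greedy_seq:
  assumes "greedy_run T l \<chi> N \<rho>" "enat n \<le> N"
  shows "greedy_seq (copies T \<chi>) (copy_pairing l) n (copy_seq \<rho>)"
  unfolding greedy_seq_def
proof (intro allI impI greedy_choice_copy_seq)
  fix k assume "k < n"
  then have "enat k < N" using order_less_le_trans[OF _ assms(2), of "enat k"] by simp
  then show "greedy_choice T l \<chi> \<rho> k (\<rho> k)" using assms(1) by (simp add: greedy_run_def)
qed

lemma greedy_value_copies:
  "greedy_value l \<rho> n = history_sum (copy_pairing l) (copy_seq \<rho>) n (copy_seq \<rho> n)"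
  by (simp add: greedy_value_def copy_seq_def history_sum_copies)

text \<open>The edges that \<open>\<tau>\<close> shares with \<open>\<rho>\<close> and with
  \<open>\<sigma>\<close> form two initial segments of \<open>\<tau>\<close>. The shorter one lies
  on all three paths, hence in the finite set of common edges of \<open>\<rho>\<close> and
  \<open>\<sigma>\<close>.\<close>

lemma (in metric_tree) pairing_ultrametric:
  assumes \<rho>: "\<rho> \<in> ext_boundary T" and \<tau>: "\<tau> \<in> ext_boundary T" and \<sigma>: "\<sigma> \<in> ext_boundary T"
    and ne: "\<rho> \<noteq> \<sigma> \<or> \<rho> \<notin> range Ray"
  shows "min (pairing l \<rho> \<tau>) (pairing l \<tau> \<sigma>) \<le> pairing l \<rho> \<sigma>"
proof -
  let ?F = "path_edges \<rho> \<inter> path_edges \<tau>" and ?G = "path_edges \<tau> \<inter> path_edges \<sigma>"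
  have "?F \<subseteq> ?G \<or> ?G \<subseteq> ?F"
  proof (rule ccontr)
    assume "\<not> ?thesis"
    then obtain a b where ab: "a \<in> ?F" "a \<notin> ?G" "b \<in> ?G" "b \<notin> ?F" by blast
    then have "a \<in> up_edges (snd b) \<or> b \<in> up_edges (snd a)"
      using path_edges_chain[OF \<tau>] by blast
    then show False
      using ab path_edges_closed[OF \<rho>, of a] path_edges_closed[OF \<sigma>, of b] by blast
  qed
  then have "?F \<subseteq> path_edges \<rho> \<inter> path_edges \<sigma> \<or> ?G \<subseteq> path_edges \<rho> \<inter> path_edges \<sigma>" by blast
  moreover have "(\<Sum>e\<in>A. l e) \<le> pairing l \<rho> \<sigma>" if "A \<subseteq> path_edges \<rho> \<inter> path_edges \<sigma>" for A
    unfolding pairing_def using that common_edges_finite[OF \<rho> \<sigma> ne]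
      path_edges_subset_E[OF \<rho>] length_pos by (intro sum_mono2) (auto intro!: less_imp_le)
  ultimately show ?thesis by (auto simp: pairing_def[of l \<rho> \<tau>] pairing_def[of l \<tau> \<sigma>] min_le_iff_disj)
qed

text \<open>A ray has a single copy, so distinct copies never pair a ray with itself and the default
  value of \<open>pairing\<close> stays out of reach.\<close>

lemma copies_distinct:
  "a \<in> copies T \<chi> \<Longrightarrow> b \<in> copies T \<chi> \<Longrightarrow> a \<noteq> b \<Longrightarrow>
    fst a \<noteq> fst b \<or> fst a \<notin> range Ray"
  by (auto simp: copies_def)

lemma copies_ext_boundary: "a \<in> copies T \<chi> \<Longrightarrow> fst a \<in> ext_boundary T"
  by (auto simp: copies_def)

lemma (in metric_tree) ultrametric_copies: "ultrametric_pairing (copies T \<chi>) (copy_pairing l)"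
proof
  fix x y :: "'v ext_path \<times> nat"
  show "copy_pairing l x y = copy_pairing l y x"
    by (simp add: copy_pairing_def pairing_def Int_commute)
next
  fix x y z assume "x \<in> copies T \<chi>" "y \<in> copies T \<chi>" "z \<in> copies T \<chi>" "x \<noteq> z"
  then show "min (copy_pairing l x y) (copy_pairing l y z) \<le> copy_pairing l x z"
    unfolding copy_pairing_def
    using copies_distinct copies_ext_boundary by (intro pairing_ultrametric) blast+
qed

section \<open>Transport along a rooted isometry\<close>

lemma rooted_isometry_inv:
  assumes "rooted_isometry T1 l1 T2 l2 f" "troot T1 \<in> tverts T1"
  shows "rooted_isometry T2 l2 T1 l1 (inv_into (realization T1 l1) f)"
proof -
  let ?g = "inv_into (realization T1 l1) f"
  have bij: "bij_betw f (realization T1 l1) (realization T2 l2)"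
    and root: "f (Vertex (troot T1)) = Vertex (troot T2)"
    using assms(1) by (auto simp: rooted_isometry_def)
  have g: "?g y \<in> realization T1 l1" "f (?g y) = y" if "y \<in> realization T2 l2" for y
    using that bij by (auto simp: bij_betw_def inv_into_into f_inv_into_f)
  have "Vertex (troot T1) \<in> realization T1 l1" using assms(2) by (simp add: realization_def)
  then have "?g (Vertex (troot T2)) = Vertex (troot T1)"
    using bij root by (metis bij_betw_inv_into_left)
  moreover have "path_metric T1 l1 (?g x) (?g y) = path_metric T2 l2 x y"
    if "x \<in> realization T2 l2" "y \<in> realization T2 l2" for x y
  proof -
    have "path_metric T2 l2 (f (?g x)) (f (?g y)) = path_metric T1 l1 (?g x) (?g y)"
      using assms(1) g(1)[OF that(1)] g(1)[OF that(2)] by (simp add: rooted_isometry_def)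
    then show ?thesis using g(2) that by simp
  qed
  ultimately show ?thesis
    using bij_betw_inv_into[OF bij] by (simp add: rooted_isometry_def)
qed

lemma carries_capacity_inv:
  assumes "carries_capacity T1 \<chi>1 T2 \<chi>2 f" "rooted_isometry T1 l1 T2 l2 f"
  shows "carries_capacity T2 \<chi>2 T1 \<chi>1 (inv_into (realization T1 l1) f)"
  unfolding carries_capacity_def
proof (intro ballI impI)
  fix w v assume w: "w \<in> leaves T2" and v: "v \<in> leaves T1"
    and eq: "inv_into (realization T1 l1) f (Vertex w) = Vertex v"
  have "Vertex w \<in> f ` realization T1 l1"
    using w assms(2) by (auto simp: leaves_def realization_def rooted_isometry_def bij_betw_def)
  then have "f (Vertex v) = Vertex w" using f_inv_into_f eq by metis
  then show "\<chi>1 v = \<chi>2 w" using assms(1) v w by (simp add: carries_capacity_def)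
qed

locale rooted_isometric_trees =
  t1: metric_tree T1 l1 + t2: metric_tree T2 l2
  for T1 :: "'v rtree" and l1 and T2 :: "'w rtree" and l2 +
  fixes f :: "'v point \<Rightarrow> 'w point"
  assumes isometry: "rooted_isometry T1 l1 T2 l2 f"
begin

lemma bij: "bij_betw f (realization T1 l1) (realization T2 l2)"
  using isometry by (simp add: rooted_isometry_def)

lemma inj: "inj_on f (realization T1 l1)"
  using bij by (simp add: bij_betw_def)

lemma f_in: "x \<in> realization T1 l1 \<Longrightarrow> f x \<in> realization T2 l2"
  using bij by (auto simp: bij_betw_def)

lemma path_metric_f:
  "x \<in> realization T1 l1 \<Longrightarrow> y \<in> realization T1 l1 \<Longrightarrow>
    path_metric T2 l2 (f x) (f y) = path_metric T1 l1 x y"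
  using isometry by (simp add: rooted_isometry_def)

lemma path_metric_f_root:
  "x \<in> realization T1 l1 \<Longrightarrow>
    path_metric T2 l2 (Vertex (troot T2)) (f x) = path_metric T1 l1 (Vertex (troot T1)) x"
  using isometry t1.root_in_V path_metric_f[of "Vertex (troot T1)" x]
  by (simp add: rooted_isometry_def)

lemma le_f_iff:
  "x \<in> realization T1 l1 \<Longrightarrow> y \<in> realization T1 l1 \<Longrightarrow>
    t2.coord (f x) \<le> t2.coord (f y) \<longleftrightarrow> t1.coord x \<le> t1.coord y"
  by (simp add: t1.le_iff_path_metric t2.le_iff_path_metric f_in path_metric_f path_metric_f_root)

lemma height_f: "x \<in> realization T1 l1 \<Longrightarrow> t2.height (f x) = t1.height x"
  using path_metric_f_root[of x] t1.path_metric_root[of x] t2.path_metric_root[of "f x"] f_in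
  by simp

lemma maximal_chain_image:
  assumes C: "t1.maximal_chain C"
  shows "t2.maximal_chain (f ` C)"
  unfolding t2.maximal_chain_def
proof (intro conjI ballI)
  have sub: "C \<subseteq> realization T1 l1" by (rule t1.maximal_chain_subset[OF C])
  then show "f ` C \<subseteq> realization T2 l2" using f_in by blast
  fix y assume "y \<in> realization T2 l2"
  then obtain x where x: "x \<in> realization T1 l1" "y = f x" using bij by (auto simp: bij_betw_def)
  have "y \<in> f ` C \<longleftrightarrow> x \<in> C" using inj_on_image_mem_iff[OF inj x(1) sub] x(2) by simp
  also have "\<dots> \<longleftrightarrow> (\<forall>z\<in>C. t1.coord x \<le> t1.coord z \<or> t1.coord z \<le> t1.coord x)"
    using C x(1) by (simp add: t1.maximal_chain_def)
  also have "\<dots> \<longleftrightarrow> (\<forall>z\<in>C. t2.coord y \<le> t2.coord (f z) \<or> t2.coord (f z) \<le> t2.coord y)"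
    using le_f_iff x sub by (intro ball_cong) (auto simp: subset_iff)
  finally show "y \<in> f ` C \<longleftrightarrow>
    (\<forall>z\<in>f ` C. t2.coord y \<le> t2.coord z \<or> t2.coord z \<le> t2.coord y)" by simp
qed

lemma has_greatest_image_iff:
  assumes "C \<subseteq> realization T1 l1"
  shows "t2.has_greatest (f ` C) \<longleftrightarrow> t1.has_greatest C"
proof -
  have "t2.coord (f x) \<le> t2.coord (f y) \<longleftrightarrow> t1.coord x \<le> t1.coord y" if "x \<in> C" "y \<in> C" for x y
    using that assms le_f_iff by blast
  then show ?thesis by (simp add: t1.has_greatest_def t2.has_greatest_def)
qed

section \<open>Correspondence between the extended boundaries\<close>

definition corresponds :: "'v ext_path \<Rightarrow> 'w ext_path \<Rightarrow> bool" where
  "corresponds \<rho> \<sigma> \<longleftrightarrow> \<rho> \<in> ext_boundary T1 \<and> \<sigma> \<in> ext_boundary T2 \<and>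
     t2.points \<sigma> = f ` t1.points \<rho>"

lemma points_subset: "t1.points \<rho> \<subseteq> realization T1 l1"
  by (auto simp: t1.points_def)

lemma corresponds_exists: "\<rho> \<in> ext_boundary T1 \<Longrightarrow> \<exists>\<sigma>. corresponds \<rho> \<sigma>"
  using t2.maximal_chain_eq_points[OF maximal_chain_image[OF t1.maximal_chain_points]]
  unfolding corresponds_def by blast

lemma corresponds_inj:
  assumes "corresponds \<rho> \<sigma>" "corresponds \<tau> \<sigma>"
  shows "\<rho> = \<tau>"
proof -
  have "f ` t1.points \<rho> = f ` t1.points \<tau>" using assms by (simp add: corresponds_def)
  then have "t1.points \<rho> = t1.points \<tau>"
    using inj_on_image_eq_iff[OF inj points_subset points_subset] by simp
  then show ?thesis using assms t1.points_inj by (auto simp: corresponds_def)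
qed

lemma corresponds_Ray_iff:
  "corresponds \<rho> \<sigma> \<Longrightarrow> \<sigma> \<in> range Ray \<longleftrightarrow> \<rho> \<in> range Ray"
  using has_greatest_image_iff[OF points_subset] t1.has_greatest_points_iff
    t2.has_greatest_points_iff
  unfolding corresponds_def by metis

lemma corresponds_pairing:
  assumes "corresponds \<rho> \<sigma>" "corresponds \<rho>' \<sigma>'" "\<rho> \<noteq> \<rho>' \<or> \<rho> \<notin> range Ray"
  shows "pairing l2 \<sigma> \<sigma>' = pairing l1 \<rho> \<rho>'"
proof -
  have "\<sigma> \<noteq> \<sigma>' \<or> \<sigma> \<notin> range Ray"
    using assms corresponds_inj corresponds_Ray_iff by metis
  then have "pairing l2 \<sigma> \<sigma>' = Sup (t2.height ` (t2.points \<sigma> \<inter> t2.points \<sigma>'))"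
    using assms by (intro t2.pairing_eq_Sup_height) (auto simp: corresponds_def)
  also have "t2.points \<sigma> \<inter> t2.points \<sigma>' = f ` (t1.points \<rho> \<inter> t1.points \<rho>')"
    using assms inj_on_image_Int[OF inj points_subset points_subset] by (simp add: corresponds_def)
  also have "t2.height ` \<dots> = t1.height ` (t1.points \<rho> \<inter> t1.points \<rho>')"
    unfolding image_image using points_subset by (intro image_cong refl height_f) blast
  also have "Sup \<dots> = pairing l1 \<rho> \<rho>'"
    using assms by (intro t1.pairing_eq_Sup_height[symmetric]) (auto simp: corresponds_def)
  finally show ?thesis .
qed

text \<open>A leaf is the greatest point of its chain, and \<open>f\<close> preserves the order, so
  it sends leaves to leaves. Hence \<open>carries_capacity\<close>, which only speaks of leaves that
  correspond, constrains every leaf.\<close>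

lemma corresponds_Leaf:
  assumes "corresponds (Leaf_Path p) \<sigma>"
  obtains q where "\<sigma> = Leaf_Path q" "last p \<in> leaves T1" "last q \<in> leaves T2"
    "f (Vertex (last p)) = Vertex (last q)"
proof -
  have ext: "Leaf_Path p \<in> ext_boundary T1" "\<sigma> \<in> ext_boundary T2"
    and pts: "t2.points \<sigma> = f ` t1.points (Leaf_Path p)"
    using assms by (simp_all add: corresponds_def)
  from ext(1) obtain v where v: "v \<in> leaves T1" "p = t1.root_path v" "last p = v"
    by (cases rule: t1.ext_boundary_cases) auto
  have "\<sigma> \<notin> range Ray" using corresponds_Ray_iff[OF assms] by auto
  with ext(2) obtain w where w: "w \<in> leaves T2" "\<sigma> = Leaf_Path (t2.root_path w)"
    "last (t2.root_path w) = w"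
    by (cases rule: t2.ext_boundary_cases) auto
  note v_top = t1.greatest_points_Leaf[OF v(1), folded v(2)]
  note w_top = t2.greatest_points_Leaf[OF w(1), folded w(2)]
  have \<Gamma>: "Vertex v \<in> realization T1 l1" "Vertex w \<in> realization T2 l2"
    using v(1) w(1) t1.leaf_iff t2.leaf_iff by simp_all
  obtain x where x: "x \<in> t1.points (Leaf_Path p)" "Vertex w = f x" using w_top(1) pts by blast
  have "x \<in> realization T1 l1" using x(1) points_subset by blast
  then have "t2.coord (Vertex w) \<le> t2.coord (f (Vertex v))"
    using v_top(2)[OF x(1)] le_f_iff[OF _ \<Gamma>(1), of x] x(2) by simp
  moreover have "t2.coord (f (Vertex v)) \<le> t2.coord (Vertex w)"
    using v_top(1) pts by (intro w_top(2)) simp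
  ultimately have "f (Vertex v) = Vertex w"
    using t2.coord_inj[OF f_in[OF \<Gamma>(1)] \<Gamma>(2)] by (simp add: order_antisym)
  then show thesis using that[of "t2.root_path w"] v w by simp
qed

lemma copies_embedding:
  assumes "carries_capacity T1 \<chi>1 T2 \<chi>2 f"
  shows "\<exists>G. pairing_embedding (copies T1 \<chi>1) (copy_pairing l1) (copies T2 \<chi>2) (copy_pairing l2) G"
proof -
  obtain g where g: "\<And>\<rho>. \<rho> \<in> ext_boundary T1 \<Longrightarrow> corresponds \<rho> (g \<rho>)"
    using corresponds_exists by metis
  let ?G = "\<lambda>(\<rho>, i). (g \<rho>, i :: nat)"
  have "inj_on ?G (copies T1 \<chi>1)"
  proof (rule inj_onI)
    fix a b assume ab: "a \<in> copies T1 \<chi>1" "b \<in> copies T1 \<chi>1" "?G a = ?G b"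
    then have "fst a = fst b"
      using corresponds_inj g[OF copies_ext_boundary[OF ab(1)]] g[OF copies_ext_boundary[OF ab(2)]]
      by (metis case_prod_beta prod.inject)
    with ab(3) show "a = b" by (simp add: case_prod_beta prod_eq_iff)
  qed
  moreover have "?G a \<in> copies T2 \<chi>2" if a: "a \<in> copies T1 \<chi>1" for a
  proof -
    obtain \<rho> i where [simp]: "a = (\<rho>, i)" by (cases a)
    have \<rho>: "corresponds \<rho> (g \<rho>)" using g copies_ext_boundary[OF a] by simp
    then have ext: "g \<rho> \<in> ext_boundary T2" by (simp add: corresponds_def)
    show ?thesis
    proof (cases \<rho>)
      case (Ray x)
      then obtain y where "g \<rho> = Ray y" using corresponds_Ray_iff[OF \<rho>] by auto
      then show ?thesis using a ext Ray by (simp add: copies_def)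
    next
      case (Leaf_Path p)
      obtain q where "g \<rho> = Leaf_Path q" "\<chi>2 (last q) = \<chi>1 (last p)"
        using corresponds_Leaf[OF \<rho>[unfolded Leaf_Path]] assms Leaf_Path
        unfolding carries_capacity_def by metis
      then show ?thesis using a ext Leaf_Path by (simp add: copies_def)
    qed
  qed
  moreover have "copy_pairing l2 (?G a) (?G b) = copy_pairing l1 a b"
    if "a \<in> copies T1 \<chi>1" "b \<in> copies T1 \<chi>1" "a \<noteq> b" for a b
    using corresponds_pairing[OF g[OF copies_ext_boundary[OF that(1)]]
        g[OF copies_ext_boundary[OF that(2)]] copies_distinct[OF that]]
    by (simp add: copy_pairing_def case_prod_beta)
  ultimately show ?thesis unfolding pairing_embedding_def by (intro exI[of _ ?G]) auto
qed

end

text \<open>If the first run stopped earlier, the second would have one more choice, from which a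
  minimizer for the first run is obtained.\<close>

lemma greedy_run_length_le:
  assumes "ultrametric_pairing (copies T1 \<chi>1) (copy_pairing l1)"
    "ultrametric_pairing (copies T2 \<chi>2) (copy_pairing l2)"
    "pairing_embedding (copies T1 \<chi>1) (copy_pairing l1) (copies T2 \<chi>2) (copy_pairing l2) G"
    "pairing_embedding (copies T2 \<chi>2) (copy_pairing l2) (copies T1 \<chi>1) (copy_pairing l1) G'"
    "greedy_run T1 l1 \<chi>1 N1 \<rho>1" "greedy_run T2 l2 \<chi>2 N2 \<rho>2"
  shows "N2 \<le> N1"
proof (rule ccontr)
  assume "\<not> N2 \<le> N1"
  then obtain n where n: "N1 = enat n" "enat (Suc n) \<le> N2"
    by (metis Suc_ile_eq enat_ord_code(3) not_enat_eq not_le)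
  have "\<exists>x. is_arg_min (history_sum (copy_pairing l1) (copy_seq \<rho>1) n)
      (\<lambda>x. x \<in> copies T1 \<chi>1 - copy_seq \<rho>1 ` {..<n}) x"
    using greedy_run_imp_greedy_seq[OF assms(5), of n] n(1)
      greedy_run_imp_greedy_seq[OF assms(6) n(2)]
    by (intro greedy_seq_extends[OF assms(1-4)]) simp_all
  then have "\<exists>\<tau>. greedy_choice T1 l1 \<chi>1 \<rho>1 n \<tau>"
    unfolding greedy_choice_iff_copies by (metis surj_pair)
  then show False using assms(5) n(1) by (simp add: greedy_run_def)
qed

theorem theorem1p3:
  fixes T1 :: "'v rtree" and T2 :: "'w rtree"
    and l1 :: "'v \<times> 'v \<Rightarrow> real" and l2 :: "'w \<times> 'w \<Rightarrow> real"
    and \<chi>1 :: "'v \<Rightarrow> enat" and \<chi>2 :: "'w \<Rightarrow> enat"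
    and f :: "'v point \<Rightarrow> 'w point"
    and N1 N2 :: enat
    and \<rho>1 :: "nat \<Rightarrow> 'v ext_path" and \<rho>2 :: "nat \<Rightarrow> 'w ext_path"
  assumes "rooted_tree T1" and "locally_finite_tree T1"
    and "length_function T1 l1" and "capacity_function T1 \<chi>1"
    and "rooted_tree T2" and "locally_finite_tree T2"
    and "length_function T2 l2" and "capacity_function T2 \<chi>2"
    and "rooted_isometry T1 l1 T2 l2 f"
    and "carries_capacity T1 \<chi>1 T2 \<chi>2 f"
    and "greedy_run T1 l1 \<chi>1 N1 \<rho>1"
    and "greedy_run T2 l2 \<chi>2 N2 \<rho>2"
  shows "N1 = N2 \<and> (\<forall>n. enat n < N1 \<longrightarrow> greedy_value l1 \<rho>1 n = greedy_value l2 \<rho>2 n)"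
proof -
  interpret t1: metric_tree T1 l1 using assms by unfold_locales
  interpret t2: metric_tree T2 l2 using assms by unfold_locales
  interpret i12: rooted_isometric_trees T1 l1 T2 l2 f using assms by unfold_locales
  let ?g = "inv_into (realization T1 l1) f"
  interpret i21: rooted_isometric_trees T2 l2 T1 l1 ?g
    using rooted_isometry_inv[OF assms(9) t1.root_in_V] by unfold_locales
  obtain G where G:
    "pairing_embedding (copies T1 \<chi>1) (copy_pairing l1) (copies T2 \<chi>2) (copy_pairing l2) G"
    using i12.copies_embedding[OF assms(10)] by blast
  obtain G' where G':
    "pairing_embedding (copies T2 \<chi>2) (copy_pairing l2) (copies T1 \<chi>1) (copy_pairing l1) G'"
    using i21.copies_embedding[OF carries_capacity_inv[OF assms(10,9)]] by blast
  note u1 = t1.ultrametric_copies[of \<chi>1] and u2 = t2.ultrametric_copies[of \<chi>2]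
  have N: "N1 = N2"
    using greedy_run_length_le[OF u1 u2 G G' assms(11,12)]
      greedy_run_length_le[OF u2 u1 G' G assms(12,11)] by (rule order_antisym[rotated])
  have "greedy_value l1 \<rho>1 n = greedy_value l2 \<rho>2 n" if "enat n < N1" for n
  proof -
    \<comment> \<open>The value with index \<open>n\<close> is a difference of totals over
      \<open>n + 1\<close> and \<open>n\<close> choices, so both runs must include choice
      \<open>n\<close>.\<close>
    have "enat (Suc n) \<le> N1" "enat (Suc n) \<le> N2" using that N by (simp_all add: Suc_ile_eq)
    then show ?thesis
      unfolding greedy_value_copies
      by (intro greedy_value_eq[OF u2 u1 G' G] greedy_run_imp_greedy_seq[OF assms(11)]
          greedy_run_imp_greedy_seq[OF assms(12)])
  qed
  with N show ?thesis by blast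
qed

end
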